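(* For $\lambda\in[P_{n+l-1}]_{\ge l}$, let $\mathcal F:=\{\rho\in[P_{n+l-1}]_{\ge l}\mid\rho\unlhd\lambda\}$. Then $\{f_T\mid T\in\mathrm{STab}(\rho,l),\ \rho\in\mathcal F\}$ is a Gröbner basis of $I_{\lambda,l}$ with respect to the lexicographic order with $x_1<\cdots<x_n$.
   Context: $K$ is an infinite field, $n,l\ge 1$ are integers, $S=K[x_1,\ldots,x_n]$. $P_m$ is the set of partitions of $m$ (non-increasing sequences of positive integers with sum $m$). The dominance order on $P_m$: for $\lambda=(\lambda_1,\ldots,\lambda_p)$, $\mu=(\mu_1,\ldots,\mu_q)$, $\lambda\unrhd\mu$ (equivalently $\mu\unlhd\lambda$) iff $\lambda_1+\cdots+\lambda_i\ge\mu_1+\cdots+\mu_i$ for $1\le i\le\min\{p,q\}$. $[P_{n+l-1}]_{\ge l}:=\{\lambda\in P_{n+l-1}\mid \lambda_1\ge l\}$. For $\lambda\in[P_{n+l-1}]_{\ge l}$, $\mathrm{Tab}(\lambda,l)$ is the set of bijective fillings $T$ of the squares of the Young diagram of $\lambda$ by the multiset consisting of one copy of each of $1,\ldots,n-1$ and $l$ copies of $n$, such that no two copies of $n$ lie in the same column. If $a_1,\ldots,a_r$ are the entries of a column from top to bottom, its difference product is $\prod_{1\le i<j\le r}(x_{a_i}-x_{a_j})$; the Specht polynomial $f_T$ is the product of the difference products of all columns of $T$. $T$ is standard if its columns are strictly increasing from top to bottom and its rows are non-decreasing from left to right; $\mathrm{STab}(\lambda,l)$ is the set of standard $T\in\mathrm{Tab}(\lambda,l)$.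 $I_{\lambda,l}:=(f_T\mid T\in\mathrm{Tab}(\lambda,l))\subset S$. *)

theory Defs
  imports Complex_Main "HOL-Library.Poly_Mapping" "HOL-Library.Multiset" "HOL-Library.FuncSet"
begin

section \<open>The polynomial ring\<close>

text \<open>A monomial is its finitely supported exponent vector. The type admits infinitely many
  variables; \<open>poly_ring n\<close> cuts out $K[x_1, \ldots, x_n]$.\<close>

type_synonym monomial = "nat \<Rightarrow>\<^sub>0 nat"
type_synonym 'k mpoly = "monomial \<Rightarrow>\<^sub>0 'k"

definition monom_poly :: "monomial \<Rightarrow> 'k::field mpoly" where
  "monom_poly m = Poly_Mapping.single m 1"

definition X :: "nat \<Rightarrow> 'k::field mpoly" where
  "X i = monom_poly (Poly_Mapping.single i 1)"

definition poly_ring :: "nat \<Rightarrow> 'k::field mpoly set" where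
  "poly_ring n = {p. \<forall>m \<in> Poly_Mapping.keys p. Poly_Mapping.keys m \<subseteq> {1..n}}"

definition ideal_gen :: "nat \<Rightarrow> 'k::field mpoly set \<Rightarrow> 'k mpoly set" where
  "ideal_gen n G = {\<Sum>g\<in>A. c g * g | A c. finite A \<and> A \<subseteq> G \<and> (\<forall>g\<in>A. c g \<in> poly_ring n)}"


section \<open>Monomial orders and Groebner bases\<close>

text \<open>The lexicographic order with $x_1 < x_2 < \cdots$: the \<^emph>\<open>largest\<close> index at which the
  exponents differ decides. (The order on exponent vectors supplied by \<^theory>\<open>HOL-Library.Poly_Mapping\<close>
  is decided at the smallest such index, that is, it has $x_1 > x_2 > \cdots$.)\<close>

definition lex_less :: "monomial \<Rightarrow> monomial \<Rightarrow> bool" where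
  "lex_less s t \<longleftrightarrow>
    (\<exists>i. Poly_Mapping.lookup s i < Poly_Mapping.lookup t i \<and>
         (\<forall>j>i. Poly_Mapping.lookup s j = Poly_Mapping.lookup t j))"

definition initial_monomial :: "(monomial \<Rightarrow> monomial \<Rightarrow> bool) \<Rightarrow> 'k::field mpoly \<Rightarrow> monomial" where
  "initial_monomial ord p =
    (THE m. m \<in> Poly_Mapping.keys p \<and> (\<forall>m' \<in> Poly_Mapping.keys p. m' \<noteq> m \<longrightarrow> ord m' m))"

definition initial_ideal ::
    "nat \<Rightarrow> (monomial \<Rightarrow> monomial \<Rightarrow> bool) \<Rightarrow> 'k::field mpoly set \<Rightarrow> 'k mpoly set" where
  "initial_ideal n ord I = ideal_gen n {monom_poly (initial_monomial ord p) | p. p \<in> I \<and> p \<noteq> 0}"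

definition is_groebner_basis ::
    "nat \<Rightarrow> (monomial \<Rightarrow> monomial \<Rightarrow> bool) \<Rightarrow> 'k::field mpoly set \<Rightarrow> 'k mpoly set \<Rightarrow> bool" where
  "is_groebner_basis n ord G I \<longleftrightarrow>
     finite G \<and> G \<subseteq> I \<and> 0 \<notin> G \<and>
     initial_ideal n ord I = ideal_gen n ((\<lambda>g. monom_poly (initial_monomial ord g)) ` G)"

lemma lex_less_irrefl: "\<not> lex_less s s"
  by (simp add: lex_less_def)

lemma lex_less_trans:
  assumes "lex_less s t" "lex_less t u"
  shows "lex_less s u"
proof -
  obtain i where i: "Poly_Mapping.lookup s i < Poly_Mapping.lookup t i"
    "\<And>k. k > i \<Longrightarrow> Poly_Mapping.lookup s k = Poly_Mapping.lookup t k"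
    using assms(1) unfolding lex_less_def by blast
  obtain j where j: "Poly_Mapping.lookup t j < Poly_Mapping.lookup u j"
    "\<And>k. k > j \<Longrightarrow> Poly_Mapping.lookup t k = Poly_Mapping.lookup u k"
    using assms(2) unfolding lex_less_def by blast
  have "Poly_Mapping.lookup s (max i j) < Poly_Mapping.lookup u (max i j)"
  proof (cases i j rule: linorder_cases)
    case less
    with i(2)[of j] j(1) show ?thesis by (simp add: max_def)
  next
    case equal
    with i(1) j(1) show ?thesis by simp
  next
    case greater
    with i(1) j(2)[of i] show ?thesis by (simp add: max_def)
  qed
  moreover have "Poly_Mapping.lookup s k = Poly_Mapping.lookup u k" if "k > max i j" for k
    using that i(2)[of k] j(2)[of k] by simp
  ultimately show ?thesis
    unfolding lex_less_def by blast
qed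

lemma lex_less_total:
  assumes "s \<noteq> t"
  shows "lex_less s t \<or> lex_less t s"
proof -
  define D where "D = {i. Poly_Mapping.lookup s i \<noteq> Poly_Mapping.lookup t i}"
  have "D \<subseteq> Poly_Mapping.keys s \<union> Poly_Mapping.keys t"
    by (auto simp: D_def in_keys_iff)
  then have fin: "finite D"
    by (rule finite_subset) simp
  have "D \<noteq> {}"
  proof
    assume "D = {}"
    then have "Poly_Mapping.lookup s i = Poly_Mapping.lookup t i" for i
      by (auto simp: D_def)
    then have "s = t"
      by (rule poly_mapping_eqI)
    with assms show False ..
  qed
  with fin have "Max D \<in> D"
    by (rule Max_in)
  then have neq: "Poly_Mapping.lookup s (Max D) \<noteq> Poly_Mapping.lookup t (Max D)"
    unfolding D_def by (rule CollectD)
  have eq: "Poly_Mapping.lookup s j = Poly_Mapping.lookup t j" if "j > Max D" for j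
  proof (rule ccontr)
    assume "Poly_Mapping.lookup s j \<noteq> Poly_Mapping.lookup t j"
    then have "j \<in> D"
      unfolding D_def by (rule CollectI)
    then have "j \<le> Max D"
      by (rule Max_ge[OF fin])
    with that show False
      by linarith
  qed
  show ?thesis
  proof (cases "Poly_Mapping.lookup s (Max D) < Poly_Mapping.lookup t (Max D)")
    case True
    then show ?thesis
      unfolding lex_less_def by (auto intro: eq)
  next
    case False
    then have "Poly_Mapping.lookup t (Max D) < Poly_Mapping.lookup s (Max D)"
      using neq by linarith
    then show ?thesis
      unfolding lex_less_def by (auto intro: eq[symmetric])
  qed
qed

lemma finite_lex_max:
  assumes "finite M" "M \<noteq> {}"
  shows "\<exists>m\<in>M. \<forall>m'\<in>M. m' \<noteq> m \<longrightarrow> lex_less m' m"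
  using assms
proof (induction M rule: finite_ne_induct)
  case (insert a M)
  then obtain m where m: "m \<in> M" "\<forall>m'\<in>M. m' \<noteq> m \<longrightarrow> lex_less m' m"
    by blast
  show ?case
  proof (cases "lex_less m a")
    case True
    have "\<forall>m'\<in>M. lex_less m' a"
    proof
      fix m' assume "m' \<in> M"
      then have "m' = m \<or> lex_less m' m"
        using m by blast
      then show "lex_less m' a"
        using True lex_less_trans[of m' m a] by metis
    qed
    then show ?thesis
      by blast
  next
    case False
    then have "a \<noteq> m \<longrightarrow> lex_less a m"
      using lex_less_total[of a m] by blast
    then show ?thesis
      using m by blast
  qed
qed simp

lemma initial_monomial_lex:
  fixes p :: "'k::field mpoly"
  assumes "p \<noteq> 0"
  shows "initial_monomial lex_less p \<in> Poly_Mapping.keys p"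
    and "\<And>m. m \<in> Poly_Mapping.keys p \<Longrightarrow> m \<noteq> initial_monomial lex_less p \<Longrightarrow>
           lex_less m (initial_monomial lex_less p)"
proof -
  have "Poly_Mapping.keys p \<noteq> {}"
    using assms by simp
  then obtain m where m: "m \<in> Poly_Mapping.keys p"
    "\<forall>m' \<in> Poly_Mapping.keys p. m' \<noteq> m \<longrightarrow> lex_less m' m"
    using finite_lex_max[of "Poly_Mapping.keys p"] by auto
  have "initial_monomial lex_less p = m"
    unfolding initial_monomial_def
  proof (rule the_equality)
    fix k
    assume k: "k \<in> Poly_Mapping.keys p \<and> (\<forall>m' \<in> Poly_Mapping.keys p. m' \<noteq> k \<longrightarrow> lex_less m' k)"
    show "k = m"
    proof (rule ccontr)
      assume "k \<noteq> m"
      then have "lex_less k m" "lex_less m k"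
        using k m by auto
      then show False
        using lex_less_trans[of k m k] lex_less_irrefl[of k] by blast
    qed
  qed (use m in blast)
  then show "initial_monomial lex_less p \<in> Poly_Mapping.keys p"
    and "\<And>m. m \<in> Poly_Mapping.keys p \<Longrightarrow> m \<noteq> initial_monomial lex_less p \<Longrightarrow>
           lex_less m (initial_monomial lex_less p)"
    using m by auto
qed


section \<open>Partitions\<close>

definition partitions :: "nat \<Rightarrow> nat list set" where
  "partitions m = {lam. sorted_wrt (\<ge>) lam \<and> (\<forall>a \<in> set lam. 0 < a) \<and> sum_list lam = m}"

definition partitions_ge :: "nat \<Rightarrow> nat \<Rightarrow> nat list set" where
  "partitions_ge m l = {lam \<in> partitions m. lam \<noteq> [] \<and> hd lam \<ge> l}"

definition dominated :: "nat list \<Rightarrow> nat list \<Rightarrow> bool"  (infix "\<unlhd>" 50) where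
  "mu \<unlhd> lam \<longleftrightarrow>
    (\<forall>i. 1 \<le> i \<and> i \<le> min (length lam) (length mu) \<longrightarrow>
         sum_list (take i lam) \<ge> sum_list (take i mu))"


section \<open>Tableaux and Specht polynomials\<close>

text \<open>The square \<open>(i, j)\<close> lies in row \<open>i\<close> (counted from the top) and column \<open>j\<close> (from the left),
  both starting at 0.\<close>

definition young_diagram :: "nat list \<Rightarrow> (nat \<times> nat) set" where
  "young_diagram lam = {(i, j). i < length lam \<and> j < lam ! i}"

text \<open>The fillings are taken undefined outside the diagram, so that equality of tableaux is
  equality of the entries in the squares.\<close>

definition Tab :: "nat \<Rightarrow> nat list \<Rightarrow> nat \<Rightarrow> (nat \<times> nat \<Rightarrow> nat) set" where
  "Tab n lam l = {T \<in> extensional (young_diagram lam).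
     image_mset T (mset_set (young_diagram lam)) = mset [1..<n] + replicate_mset l n \<and>
     (\<forall>i i' j. (i, j) \<in> young_diagram lam \<and> (i', j) \<in> young_diagram lam \<and>
        T (i, j) = n \<and> T (i', j) = n \<longrightarrow> i = i')}"

definition STab :: "nat \<Rightarrow> nat list \<Rightarrow> nat \<Rightarrow> (nat \<times> nat \<Rightarrow> nat) set" where
  "STab n lam l = {T \<in> Tab n lam l.
     (\<forall>i i' j. i < i' \<and> (i, j) \<in> young_diagram lam \<and> (i', j) \<in> young_diagram lam \<longrightarrow>
        T (i, j) < T (i', j)) \<and>
     (\<forall>i j j'. j < j' \<and> (i, j) \<in> young_diagram lam \<and> (i, j') \<in> young_diagram lam \<longrightarrow>
        T (i, j) \<le> T (i, j'))}"

definition column :: "nat list \<Rightarrow> (nat \<times> nat \<Rightarrow> nat) \<Rightarrow> nat \<Rightarrow> nat list" where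
  "column lam T j = map (\<lambda>i. T (i, j)) (filter (\<lambda>i. (i, j) \<in> young_diagram lam) [0..<length lam])"

definition difference_product :: "nat list \<Rightarrow> 'k::field mpoly" where
  "difference_product a =
    (\<Prod>(i, j) \<in> {(i, j). i < j \<and> j < length a}. X (a ! i) - X (a ! j))"

definition specht_poly :: "nat list \<Rightarrow> (nat \<times> nat \<Rightarrow> nat) \<Rightarrow> 'k::field mpoly" where
  "specht_poly lam T = (\<Prod>j \<in> snd ` young_diagram lam. difference_product (column lam T j))"

definition specht_ideal :: "nat \<Rightarrow> nat list \<Rightarrow> nat \<Rightarrow> 'k::field mpoly set" where
  "specht_ideal n lam l = ideal_gen n (specht_poly lam ` Tab n lam l)"

end

theory Submission
  imports Defs "HOL-Computational_Algebra.Polynomial"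
begin

text \<open>
  For a standard tableau \<open>T\<close> of shape \<open>\<rho>\<close> the initial monomial of \<open>f\<^sub>T\<close> is the product of \<open>x\<^bsub>T(i,j)\<^esub>\<^sup>i\<close>
  over the squares \<open>(i, j)\<close>, the rows being counted from 0 (\<open>leading_specht_poly\<close>). So two things have
  to be shown: that \<open>f\<^sub>T\<close> lies in the ideal of \<open>\<lambda>\<close> if \<open>\<rho> \<unlhd> \<lambda>\<close>, and that the initial monomial of each
  nonzero element of this ideal is divisible by such a product, for some \<open>T\<close> of a shape \<open>\<rho> \<unlhd> \<lambda>\<close>.

  The first claim (\<open>specht_ideal_dominated\<close>) reduces to moving one square of a diagram up. This
  replaces two columns, one of them losing an entry to the other, and an identity of Laplace type
  (\<open>difference_product_exchange\<close>) expresses the product of the two old difference products by those of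
  the possible new pairs.

  For the second claim let \<open>f\<close> be in the ideal, let \<open>d\<close> be its degree in the largest variable \<open>x\<^sub>n\<close>,
  and let \<open>g\<close> be its coefficient at \<open>x\<^sub>n\<^sup>d\<close>, a polynomial in one variable less. Consider a point
  where \<open>g\<close> is nonzero, and let \<open>\<mu>\<close> be the partition of \<open>n - 1\<close> formed by the multiplicities of its
  coordinates. On the line over this point \<open>f\<close> becomes a univariate polynomial of degree \<open>d\<close>. A generator
  \<open>f\<^sub>T\<close> is zero there or vanishes at a value \<open>v\<close> to an order no less than the number of columns in which \<open>v\<close>
  meets the variable, and counting squares bounds this number from below for all fillings of \<open>\<lambda>\<close> at
  once (\<open>required_overlap\<close>). The sum of these bounds is thus at most \<open>d\<close>. The same bounds describe a
  horizontal strip of \<open>l\<close> squares that extends \<open>\<mu>\<close> to a shape \<open>\<rho> \<unlhd> \<lambda>\<close>, the sum of the row indices of the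
  strip being the sum of the bounds (\<open>ex_horizontal_strip\<close>). So \<open>g\<close> vanishes at all points except
  those whose type \<open>\<mu>\<close> has such an extension of weight at most \<open>d\<close>.

  This suffices, by a statement about polynomials that vanish at all points with types outside of a
  set \<open>F\<close> of partitions (\<open>initial_monomial_of_vanishing_poly\<close>): their initial monomials are divisible by
  those of standard tableaux with a shape in \<open>F\<close> and each entry used once. It is proved by eliminating
  one variable after the other in a similar way. Applied to \<open>g\<close> it yields a standard tableau of a shape \<open>\<mu>\<close> as above, and
  filling the strip with the \<open>l\<close> copies of \<open>n\<close> gives \<open>T\<close> (\<open>standard_filling_extend_divides\<close>).
\<close>

section \<open>Leading monomials\<close>

text \<open>Unlike \<^const>\<open>initial_monomial\<close>, a definite description that says nothing about the zero
  polynomial, this relation entails that the polynomial is nonzero.\<close>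

definition leading :: "'k::field mpoly \<Rightarrow> monomial \<Rightarrow> bool" where
  "leading p m \<longleftrightarrow> m \<in> Poly_Mapping.keys p \<and> (\<forall>m' \<in> Poly_Mapping.keys p. m' \<noteq> m \<longrightarrow> lex_less m' m)"

lemma leading_initial_monomial:
  "p \<noteq> 0 \<Longrightarrow> leading p (initial_monomial lex_less p)"
  unfolding leading_def using initial_monomial_lex[of p] by blast

lemma leading_unique: "leading p m \<Longrightarrow> leading p m' \<Longrightarrow> m = m'"
  unfolding leading_def using lex_less_irrefl lex_less_trans by metis

lemma leading_nonzero: "leading p m \<Longrightarrow> p \<noteq> 0"
  by (auto simp: leading_def)

lemma initial_monomial_eq: "leading p m \<Longrightarrow> initial_monomial lex_less p = m"
  using leading_initial_monomial leading_unique leading_nonzero by blast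

lemma lex_less_add_right: "lex_less s t \<Longrightarrow> lex_less (s + u) (t + u)"
  unfolding lex_less_def by (auto simp: lookup_add)

lemma lex_less_add_left: "lex_less s t \<Longrightarrow> lex_less (u + s) (u + t)"
  unfolding lex_less_def by (auto simp: lookup_add)

lemma lex_less_add: "lex_less s t \<Longrightarrow> lex_less s' t' \<Longrightarrow> lex_less (s + s') (t + t')"
  by (meson lex_less_add_right lex_less_add_left lex_less_trans)

text \<open>Splitting off the leading term makes multiplicativity a matter of multiplying out.\<close>

lemma leading_iff:
  "leading p m \<longleftrightarrow> (\<exists>c p'. c \<noteq> 0 \<and> p = Poly_Mapping.single m c + p' \<and> (\<forall>k\<in>Poly_Mapping.keys p'. lex_less k m))"
proof
  assume m: "leading p m"
  define p' where "p' = p - Poly_Mapping.single m (Poly_Mapping.lookup p m)"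
  have "lex_less k m" if "k \<in> Poly_Mapping.keys p'" for k
  proof -
    have "Poly_Mapping.lookup p k \<noteq> (Poly_Mapping.lookup p m when m = k)"
      using that by (simp add: in_keys_iff p'_def lookup_minus lookup_single)
    then have "k \<noteq> m" "k \<in> Poly_Mapping.keys p"
      by (auto simp: in_keys_iff)
    then show ?thesis
      using m unfolding leading_def by blast
  qed
  moreover have "p = Poly_Mapping.single m (Poly_Mapping.lookup p m) + p'"
    by (simp add: p'_def)
  moreover have "Poly_Mapping.lookup p m \<noteq> 0"
    using m by (simp add: leading_def in_keys_iff)
  ultimately show "\<exists>c p'. c \<noteq> 0 \<and> p = Poly_Mapping.single m c + p' \<and> (\<forall>k\<in>Poly_Mapping.keys p'. lex_less k m)"
    by blast
next
  assume "\<exists>c p'. c \<noteq> 0 \<and> p = Poly_Mapping.single m c + p' \<and> (\<forall>k\<in>Poly_Mapping.keys p'. lex_less k m)"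
  then obtain c p' where c: "c \<noteq> 0" "p = Poly_Mapping.single m c + p'" "\<forall>k\<in>Poly_Mapping.keys p'. lex_less k m"
    by blast
  then have "m \<notin> Poly_Mapping.keys p'"
    using lex_less_irrefl by blast
  then have "Poly_Mapping.lookup p m = c"
    by (simp add: c(2) lookup_add in_keys_iff)
  moreover have "lex_less m' m" if "m' \<in> Poly_Mapping.keys p" "m' \<noteq> m" for m'
    using that c by (auto simp: in_keys_iff lookup_add lookup_single)
  ultimately show "leading p m"
    using c(1) by (simp add: leading_def in_keys_iff)
qed

lemma leading_mult:
  assumes "leading p m" "leading q m'"
  shows "leading (p * q) (m + m')"
proof -
  obtain c p' where p: "c \<noteq> 0" "p = Poly_Mapping.single m c + p'" "\<forall>k\<in>Poly_Mapping.keys p'. lex_less k m"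
    using assms(1) unfolding leading_iff by blast
  obtain d q' where q: "d \<noteq> 0" "q = Poly_Mapping.single m' d + q'" "\<forall>k\<in>Poly_Mapping.keys q'. lex_less k m'"
    using assms(2) unfolding leading_iff by blast
  define r where "r = Poly_Mapping.single m c * q' + p' * q"
  have pq: "p * q = Poly_Mapping.single (m + m') (c * d) + r"
    by (simp add: r_def p(2) q(2) algebra_simps mult_single)
  have "lex_less k (m + m')" if "k \<in> Poly_Mapping.keys r" for k
  proof -
    consider "k \<in> Poly_Mapping.keys (Poly_Mapping.single m c * q')" | "k \<in> Poly_Mapping.keys (p' * q)"
      using \<open>k \<in> Poly_Mapping.keys r\<close> keys_add[of "Poly_Mapping.single m c * q'" "p' * q"]
      unfolding r_def by blast
    then show ?thesis
    proof cases
      case 1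
      then obtain b where "k = m + b" "b \<in> Poly_Mapping.keys q'"
        using keys_mult[of "Poly_Mapping.single m c" q'] p(1) by auto
      then show ?thesis
        using q(3) lex_less_add_left by blast
    next
      case 2
      then obtain a b where k: "k = a + b" "a \<in> Poly_Mapping.keys p'" "b \<in> Poly_Mapping.keys q"
        using keys_mult[of p' q] by auto
      then have "b = m' \<or> lex_less b m'"
        using assms(2) unfolding leading_def by blast
      then show ?thesis
        using k p(3) lex_less_add lex_less_add_right by blast
    qed
  qed
  then show ?thesis
    unfolding leading_iff using pq p(1) q(1) by (metis mult_eq_0_iff)
qed

lemma leading_one: "leading 1 0"
  by (simp add: leading_def)

lemma leading_prod:
  assumes "\<And>i. i \<in> A \<Longrightarrow> leading (f i) (m i)"
  shows "leading (\<Prod>i\<in>A. f i) (\<Sum>i\<in>A. m i)"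
  using assms
  by (induction A rule: infinite_finite_induct) (auto simp: leading_one leading_mult)

lemma leading_X_diff:
  assumes "a < b"
  shows "leading (X a - X b) (Poly_Mapping.single b 1)"
proof -
  have "lex_less (Poly_Mapping.single a 1) (Poly_Mapping.single b 1)"
    unfolding lex_less_def using assms
    by (intro exI[of _ b]) (auto simp: lookup_single when_def)
  moreover have "X a - X b = Poly_Mapping.single (Poly_Mapping.single b 1) (-1) + Poly_Mapping.single (Poly_Mapping.single a 1) (1::'a)"
    by (simp add: X_def monom_poly_def single_uminus)
  ultimately show ?thesis
    unfolding leading_iff by (metis keys_single neg_equal_0_iff_equal one_neq_zero singletonD)
qed

text \<open>In a strictly increasing list the entry at position \<open>j\<close> is the larger variable in exactly \<open>j\<close>
  of the factors, and the larger variable leads.\<close>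

lemma leading_difference_product:
  assumes "sorted_wrt (<) a"
  shows "leading (difference_product a) (\<Sum>j<length a. Poly_Mapping.single (a ! j) j)"
proof -
  let ?P = "{(i, j). i < j \<and> j < length a}"
  have "leading (difference_product a) (\<Sum>(i, j)\<in>?P. Poly_Mapping.single (a ! j) 1)"
    unfolding difference_product_def
  proof (rule leading_prod)
    fix x assume "x \<in> ?P"
    then obtain i j where x: "x = (i, j)" "i < j" "j < length a"
      by blast
    then have "a ! i < a ! j"
      using assms by (simp add: sorted_wrt_iff_nth_less)
    then show "leading (case x of (i, j) \<Rightarrow> X (a ! i) - X (a ! j))
        (case x of (i, j) \<Rightarrow> Poly_Mapping.single (a ! j) 1)"
      using leading_X_diff by (simp add: x(1))
  qed
  also have "(\<Sum>(i, j)\<in>?P. Poly_Mapping.single (a ! j) (1::nat))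
      = (\<Sum>(j, i)\<in>(SIGMA j:{..<length a}. {..<j}). Poly_Mapping.single (a ! j) 1)"
    by (rule sum.reindex_bij_witness[where i="\<lambda>(j, i). (i, j)" and j="\<lambda>(i, j). (j, i)"]) auto
  also have "\<dots> = (\<Sum>j<length a. \<Sum>i<j. Poly_Mapping.single (a ! j) 1)"
    by (rule sum.Sigma[symmetric]) simp_all
  also have "\<dots> = (\<Sum>j<length a. Poly_Mapping.single (a ! j) j)"
  proof (rule sum.cong)
    fix j
    have "(\<Sum>i<k. Poly_Mapping.single (a ! j) (1::nat)) = Poly_Mapping.single (a ! j) k" for k
      by (induction k) (auto simp: single_add[symmetric] simp del: sum_constant)
    then show "(\<Sum>i<j. Poly_Mapping.single (a ! j) (1::nat)) = Poly_Mapping.single (a ! j) j" .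
  qed simp
  finally show ?thesis .
qed

section \<open>Ideals and a criterion for Groebner bases\<close>

lemma zero_in_poly_ring [simp]: "0 \<in> poly_ring n"
  by (simp add: poly_ring_def)

lemma one_in_poly_ring [simp]: "1 \<in> poly_ring n"
  by (simp add: poly_ring_def)

lemma add_in_poly_ring: "p \<in> poly_ring n \<Longrightarrow> q \<in> poly_ring n \<Longrightarrow> p + q \<in> poly_ring n"
  unfolding poly_ring_def using keys_add by fastforce

lemma mult_in_poly_ring:
  assumes "p \<in> poly_ring n" "q \<in> poly_ring n"
  shows "p * q \<in> poly_ring n"
  unfolding poly_ring_def
proof (intro CollectI ballI)
  fix m assume "m \<in> Poly_Mapping.keys (p * q)"
  then obtain a b where "m = a + b" "a \<in> Poly_Mapping.keys p" "b \<in> Poly_Mapping.keys q"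
    using keys_mult[of p q] by blast
  then show "Poly_Mapping.keys m \<subseteq> {1..n}"
    using assms keys_add[of a b] unfolding poly_ring_def by blast
qed

lemma uminus_in_poly_ring: "p \<in> poly_ring n \<Longrightarrow> - p \<in> poly_ring n"
  unfolding poly_ring_def by (auto simp: in_keys_iff)

lemma diff_in_poly_ring: "p \<in> poly_ring n \<Longrightarrow> q \<in> poly_ring n \<Longrightarrow> p - q \<in> poly_ring n"
  using add_in_poly_ring[of p n "- q"] uminus_in_poly_ring by auto

lemma power_in_poly_ring: "p \<in> poly_ring n \<Longrightarrow> p ^ k \<in> poly_ring n"
  by (induction k) (auto intro: mult_in_poly_ring)

lemma prod_in_poly_ring: "(\<And>i. i \<in> A \<Longrightarrow> f i \<in> poly_ring n) \<Longrightarrow> (\<Prod>i\<in>A. f i) \<in> poly_ring n"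
  by (induction A rule: infinite_finite_induct) (auto intro: mult_in_poly_ring)

lemma sum_in_poly_ring: "(\<And>i. i \<in> A \<Longrightarrow> f i \<in> poly_ring n) \<Longrightarrow> (\<Sum>i\<in>A. f i) \<in> poly_ring n"
  by (induction A rule: infinite_finite_induct) (auto intro: add_in_poly_ring)

lemma X_in_poly_ring: "1 \<le> i \<Longrightarrow> i \<le> n \<Longrightarrow> X i \<in> poly_ring n"
  by (simp add: X_def monom_poly_def poly_ring_def)

lemma difference_product_in_poly_ring:
  "set a \<subseteq> {1..n} \<Longrightarrow> difference_product a \<in> poly_ring n"
  unfolding difference_product_def
  by (rule prod_in_poly_ring)
    (auto intro!: diff_in_poly_ring X_in_poly_ring simp: subset_iff dest: less_trans simp: all_set_conv_all_nth)

lemma zero_in_ideal_gen: "0 \<in> ideal_gen n G"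
  unfolding ideal_gen_def by (intro CollectI exI[of _ "{}"]) auto

lemma generator_in_ideal_gen: "g \<in> G \<Longrightarrow> g \<in> ideal_gen n G"
  unfolding ideal_gen_def
  by (intro CollectI exI[of _ "{g}"] exI[of _ "\<lambda>_. 1"]) auto

lemma ideal_gen_mono: "G \<subseteq> H \<Longrightarrow> ideal_gen n G \<subseteq> ideal_gen n H"
  unfolding ideal_gen_def by blast

lemma ideal_gen_add:
  assumes "p \<in> ideal_gen n G" "q \<in> ideal_gen n G"
  shows "p + q \<in> ideal_gen n G"
proof -
  obtain A c where A: "p = (\<Sum>g\<in>A. c g * g)" "finite A" "A \<subseteq> G" "\<forall>g\<in>A. c g \<in> poly_ring n"
    using assms(1) unfolding ideal_gen_def by blast
  obtain B d where B: "q = (\<Sum>g\<in>B. d g * g)" "finite B" "B \<subseteq> G" "\<forall>g\<in>B. d g \<in> poly_ring n"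
    using assms(2) unfolding ideal_gen_def by blast
  define c' where "c' g = (if g \<in> A then c g else 0)" for g
  define d' where "d' g = (if g \<in> B then d g else 0)" for g
  have "p = (\<Sum>g\<in>A \<union> B. c' g * g)"
    unfolding A(1) by (rule sum.mono_neutral_cong_left) (auto simp: c'_def A B)
  moreover have "q = (\<Sum>g\<in>A \<union> B. d' g * g)"
    unfolding B(1) by (rule sum.mono_neutral_cong_left) (auto simp: d'_def A B)
  ultimately have "p + q = (\<Sum>g\<in>A \<union> B. (c' g + d' g) * g)"
    by (simp add: sum.distrib distrib_right)
  moreover have "\<forall>g\<in>A \<union> B. c' g + d' g \<in> poly_ring n"
    using A(4) B(4) by (auto simp: c'_def d'_def intro: add_in_poly_ring)
  ultimately show ?thesis
    unfolding ideal_gen_def using A(2,3) B(2,3)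
    by (intro CollectI exI[of _ "A \<union> B"] exI[of _ "\<lambda>g. c' g + d' g"]) auto
qed

lemma ideal_gen_mult:
  assumes "p \<in> ideal_gen n G" "r \<in> poly_ring n"
  shows "r * p \<in> ideal_gen n G"
proof -
  obtain A c where A: "p = (\<Sum>g\<in>A. c g * g)" "finite A" "A \<subseteq> G" "\<forall>g\<in>A. c g \<in> poly_ring n"
    using assms(1) unfolding ideal_gen_def by blast
  have "r * p = (\<Sum>g\<in>A. (r * c g) * g)"
    unfolding A(1) by (simp add: sum_distrib_left mult.assoc)
  moreover have "\<forall>g\<in>A. r * c g \<in> poly_ring n"
    using A(4) assms(2) mult_in_poly_ring by blast
  ultimately show ?thesis
    unfolding ideal_gen_def using A(2,3)
    by (intro CollectI exI[of _ A] exI[of _ "\<lambda>g. r * c g"]) auto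
qed

lemma ideal_gen_sum: "(\<And>i. i \<in> A \<Longrightarrow> f i \<in> ideal_gen n G) \<Longrightarrow> (\<Sum>i\<in>A. f i) \<in> ideal_gen n G"
  by (induction A rule: infinite_finite_induct) (auto intro: ideal_gen_add zero_in_ideal_gen)

lemma ideal_gen_subset_poly_ring: "G \<subseteq> poly_ring n \<Longrightarrow> ideal_gen n G \<subseteq> poly_ring n"
  unfolding ideal_gen_def by (auto intro!: sum_in_poly_ring mult_in_poly_ring)

lemma ideal_gen_least: "G \<subseteq> ideal_gen n H \<Longrightarrow> ideal_gen n G \<subseteq> ideal_gen n H"
  by (subst (1) ideal_gen_def) (auto intro!: ideal_gen_sum ideal_gen_mult)

text \<open>Divisibility of monomials is pointwise comparison of exponents; the quotient stays in
  \<open>poly_ring n\<close> because it divides a monomial of \<open>p\<close>.\<close>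

lemma groebner_basisI:
  fixes I :: "'k::field mpoly set"
  assumes "finite G" "G \<subseteq> I" "0 \<notin> G" "I \<subseteq> poly_ring n"
    and div: "\<And>p. p \<in> I \<Longrightarrow> p \<noteq> 0 \<Longrightarrow> \<exists>g\<in>G. \<forall>i.
      Poly_Mapping.lookup (initial_monomial lex_less g) i \<le> Poly_Mapping.lookup (initial_monomial lex_less p) i"
  shows "is_groebner_basis n lex_less G I"
proof -
  let ?in = "\<lambda>p :: 'k mpoly. initial_monomial lex_less p"
  let ?M = "(\<lambda>g. monom_poly (?in g)) ` G :: 'k mpoly set"
  have "{monom_poly (?in p) | p. p \<in> I \<and> p \<noteq> 0} \<subseteq> ideal_gen n ?M"
  proof (safe)
    fix p assume p: "p \<in> I" "p \<noteq> 0"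
    then obtain g where g: "g \<in> G" "\<forall>i. Poly_Mapping.lookup (?in g) i \<le> Poly_Mapping.lookup (?in p) i"
      using div by blast
    define q where "q = ?in p - ?in g"
    have q: "?in p = q + ?in g"
      by (rule poly_mapping_eqI) (use g(2) in \<open>simp add: q_def lookup_add lookup_minus\<close>)
    have "?in p \<in> Poly_Mapping.keys p"
      using leading_initial_monomial[OF p(2)] by (simp add: leading_def)
    then have "Poly_Mapping.keys (?in p) \<subseteq> {1..n}"
      using p(1) \<open>I \<subseteq> poly_ring n\<close> unfolding poly_ring_def by blast
    moreover have "Poly_Mapping.keys q \<subseteq> Poly_Mapping.keys (?in p)"
      by (auto simp: q in_keys_iff lookup_add)
    ultimately have "monom_poly q \<in> (poly_ring n :: 'k mpoly set)"
      by (auto simp: poly_ring_def monom_poly_def)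
    moreover have "(monom_poly (?in p) :: 'k mpoly) = monom_poly q * monom_poly (?in g)"
      by (simp add: monom_poly_def mult_single q)
    moreover have "(monom_poly (?in g) :: 'k mpoly) \<in> ideal_gen n ?M"
      using g(1) by (intro generator_in_ideal_gen) simp
    ultimately show "monom_poly (?in p) \<in> ideal_gen n ?M"
      using ideal_gen_mult by metis
  qed
  then have "initial_ideal n lex_less I \<subseteq> ideal_gen n ?M"
    unfolding initial_ideal_def by (rule ideal_gen_least)
  moreover have "ideal_gen n ?M \<subseteq> initial_ideal n lex_less I"
    unfolding initial_ideal_def by (rule ideal_gen_mono) (use assms(2,3) in blast)
  ultimately show ?thesis
    using assms(1-3) by (simp add: is_groebner_basis_def)
qed

section \<open>Evaluation\<close>

abbreviation mono_value :: "(nat \<Rightarrow> 'b::comm_ring_1) \<Rightarrow> monomial \<Rightarrow> 'b" where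
  "mono_value a m \<equiv> \<Prod>i\<in>Poly_Mapping.keys m. a i ^ Poly_Mapping.lookup m i"

lemma mono_value_superset:
  "finite A \<Longrightarrow> Poly_Mapping.keys m \<subseteq> A \<Longrightarrow>
    mono_value a m = (\<Prod>i\<in>A. a i ^ Poly_Mapping.lookup m i)"
  by (rule prod.mono_neutral_left) (auto simp: in_keys_iff)

lemma mono_value_add: "mono_value a (m + m') = mono_value a m * mono_value a m'"
proof -
  let ?A = "Poly_Mapping.keys m \<union> Poly_Mapping.keys m'"
  have "mono_value a (m + m') = (\<Prod>i\<in>?A. a i ^ Poly_Mapping.lookup (m + m') i)"
    by (rule mono_value_superset) (use keys_add[of m m'] in auto)
  moreover have "mono_value a m = (\<Prod>i\<in>?A. a i ^ Poly_Mapping.lookup m i)"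
    by (rule mono_value_superset) auto
  moreover have "mono_value a m' = (\<Prod>i\<in>?A. a i ^ Poly_Mapping.lookup m' i)"
    by (rule mono_value_superset) auto
  ultimately show ?thesis
    by (simp add: lookup_add power_add prod.distrib)
qed

text \<open>The substitution \<open>x\<^sub>i \<mapsto> a i\<close>, with \<open>h\<close> carrying the coefficients into the target ring. Two
  targets occur: the field itself, for values at points, and the univariate polynomials, for
  restrictions to a line parallel to a coordinate axis.\<close>

definition insertion :: "('k::field \<Rightarrow> 'b::comm_ring_1) \<Rightarrow> (nat \<Rightarrow> 'b) \<Rightarrow> 'k mpoly \<Rightarrow> 'b" where
  "insertion h a p = (\<Sum>m\<in>Poly_Mapping.keys p. h (Poly_Mapping.lookup p m) *
     mono_value a m)"

lemma sum_of_monomials: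
  "(p :: 'k::field mpoly) = (\<Sum>m\<in>Poly_Mapping.keys p. Poly_Mapping.single m (Poly_Mapping.lookup p m))"
  by (rule poly_mapping_eqI) (auto simp: lookup_sum lookup_single when_def in_keys_iff)

locale ring_homomorphism =
  fixes h :: "'k::field \<Rightarrow> 'b::comm_ring_1"
  assumes hom_add: "h (x + y) = h x + h y"
    and hom_mult: "h (x * y) = h x * h y"
    and hom_one: "h 1 = 1"
begin

lemma hom_zero: "h 0 = 0"
  using hom_add[of 0 0] by simp

lemma insertion_superset:
  "finite A \<Longrightarrow> Poly_Mapping.keys p \<subseteq> A \<Longrightarrow>
    insertion h a p = (\<Sum>m\<in>A. h (Poly_Mapping.lookup p m) * mono_value a m)"
  unfolding insertion_def by (rule sum.mono_neutral_left) (auto simp: in_keys_iff hom_zero)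

lemma insertion_zero [simp]: "insertion h a 0 = 0"
  by (simp add: insertion_def)

lemma insertion_single: "insertion h a (Poly_Mapping.single m c) = h c * mono_value a m"
  by (simp add: insertion_def hom_zero)

lemma insertion_one [simp]: "insertion h a 1 = 1"
  by (simp add: insertion_def lookup_one hom_one)

lemma insertion_X [simp]: "insertion h a (X i) = a i"
  by (simp add: X_def monom_poly_def insertion_single hom_one)

lemma insertion_add: "insertion h a (p + q) = insertion h a p + insertion h a q"
proof -
  let ?A = "Poly_Mapping.keys p \<union> Poly_Mapping.keys q"
  have "insertion h a (p + q) = (\<Sum>m\<in>?A. h (Poly_Mapping.lookup (p + q) m) * mono_value a m)"
    by (rule insertion_superset) (use keys_add[of p q] in auto)
  moreover have "insertion h a p = (\<Sum>m\<in>?A. h (Poly_Mapping.lookup p m) * mono_value a m)"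
    by (rule insertion_superset) auto
  moreover have "insertion h a q = (\<Sum>m\<in>?A. h (Poly_Mapping.lookup q m) * mono_value a m)"
    by (rule insertion_superset) auto
  ultimately show ?thesis
    by (simp add: lookup_add hom_add algebra_simps sum.distrib)
qed

lemma insertion_sum: "insertion h a (\<Sum>i\<in>A. f i) = (\<Sum>i\<in>A. insertion h a (f i))"
  by (induction A rule: infinite_finite_induct) (auto simp: insertion_add)

lemma insertion_diff: "insertion h a (p - q) = insertion h a p - insertion h a q"
  using insertion_add[of a "p - q" q] by simp

lemma insertion_mult: "insertion h a (p * q) = insertion h a p * insertion h a q"
proof -
  have "p * q = (\<Sum>m\<in>Poly_Mapping.keys p. \<Sum>m'\<in>Poly_Mapping.keys q.
      Poly_Mapping.single (m + m') (Poly_Mapping.lookup p m * Poly_Mapping.lookup q m'))"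
    by (subst (1) sum_of_monomials[of p], subst (1) sum_of_monomials[of q])
      (simp add: sum_product mult_single)
  then have "insertion h a (p * q) = (\<Sum>m\<in>Poly_Mapping.keys p. \<Sum>m'\<in>Poly_Mapping.keys q.
      h (Poly_Mapping.lookup p m * Poly_Mapping.lookup q m') * mono_value a (m + m'))"
    by (simp only: insertion_sum insertion_single)
  also have "\<dots> = insertion h a p * insertion h a q"
    by (simp add: insertion_def sum_product hom_mult mono_value_add mult_ac)
  finally show ?thesis .
qed

lemma insertion_prod: "insertion h a (\<Prod>i\<in>A. f i) = (\<Prod>i\<in>A. insertion h a (f i))"
  by (induction A rule: infinite_finite_induct) (auto simp: insertion_mult)

lemma insertion_difference_product:
  "insertion h a (difference_product xs) = (\<Prod>(i, j)\<in>{(i, j). i < j \<and> j < length xs}. a (xs ! i) - a (xs ! j))"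
  by (simp add: difference_product_def insertion_prod insertion_diff case_prod_unfold)

end

interpretation const_hom: ring_homomorphism "\<lambda>c :: 'k::field. [:c:]"
  by unfold_locales (simp_all add: one_pCons)

abbreviation mpeval :: "(nat \<Rightarrow> 'k::field) \<Rightarrow> 'k mpoly \<Rightarrow> 'k" where
  "mpeval a p \<equiv> insertion (\<lambda>c. c) a p"

text \<open>The point \<open>a\<close> with its coordinate \<open>n\<close> freed: substituting it gives the restriction of a
  polynomial to the line through \<open>a\<close> in the direction of the variable \<open>n\<close>.\<close>

definition line :: "(nat \<Rightarrow> 'k::field) \<Rightarrow> nat \<Rightarrow> nat \<Rightarrow> 'k poly" where
  "line a n i = (if i = n then [:0, 1:] else [:a i:])"

abbreviation fibre_poly :: "(nat \<Rightarrow> 'k::field) \<Rightarrow> nat \<Rightarrow> 'k mpoly \<Rightarrow> 'k poly" where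
  "fibre_poly a n p \<equiv> insertion (\<lambda>c. [:c:]) (line a n) p"

lemma poly_fibre_poly: "poly (fibre_poly a n p) t = mpeval (a(n := t)) p"
  unfolding insertion_def
  by (auto simp: poly_sum poly_prod line_def intro!: sum.cong prod.cong)

text \<open>The homogeneous part of degree \<open>d\<close> in the variable \<open>n\<close>. The factor \<open>x\<^sub>n\<^sup>d\<close> is kept, so that
  monomials need not be divided; setting \<open>x\<^sub>n = 1\<close> removes it under evaluation. This is why points
  below have coordinate 1 at the variables already treated.\<close>

definition degree_part :: "nat \<Rightarrow> nat \<Rightarrow> 'k::field mpoly \<Rightarrow> 'k mpoly" where
  "degree_part n d p = (\<Sum>m | m \<in> Poly_Mapping.keys p \<and> Poly_Mapping.lookup m n = d.
     Poly_Mapping.single m (Poly_Mapping.lookup p m))"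

lemma lookup_degree_part:
  "Poly_Mapping.lookup (degree_part n d p) m = (if Poly_Mapping.lookup m n = d then Poly_Mapping.lookup p m else 0)"
proof -
  have "Poly_Mapping.lookup (degree_part n d p) m =
     (\<Sum>m' | m' \<in> Poly_Mapping.keys p \<and> Poly_Mapping.lookup m' n = d. if m' = m then Poly_Mapping.lookup p m else 0)"
    unfolding degree_part_def lookup_sum by (rule sum.cong) (auto simp: lookup_single)
  then show ?thesis
    by (subst (asm) sum.delta) (auto simp: in_keys_iff)
qed

lemma keys_degree_part:
  "Poly_Mapping.keys (degree_part n d p) = {m \<in> Poly_Mapping.keys p. Poly_Mapping.lookup m n = d}"
  by (auto simp: in_keys_iff lookup_degree_part split: if_splits)

lemma const_prod: "(\<Prod>i\<in>B. [:f i:]) = [:\<Prod>i\<in>B. f i:]" for f :: "'i \<Rightarrow> 'k::comm_ring_1"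
  by (induction B rule: infinite_finite_induct) (auto simp: one_pCons)

lemma coeff_fibre_poly:
  assumes "a n = 1"
  shows "coeff (fibre_poly a n p) d = mpeval a (degree_part n d p)"
proof -
  have *: "mono_value (line a n) m = monom (mono_value a m) (Poly_Mapping.lookup m n)" for m
  proof -
    let ?A = "insert n (Poly_Mapping.keys m)"
    have "mono_value (line a n) m = (\<Prod>i\<in>?A. line a n i ^ Poly_Mapping.lookup m i)"
      by (rule mono_value_superset) auto
    also have "\<dots> = line a n n ^ Poly_Mapping.lookup m n * (\<Prod>i\<in>?A - {n}. line a n i ^ Poly_Mapping.lookup m i)"
      by (rule prod.remove) auto
    also have "(\<Prod>i\<in>?A - {n}. line a n i ^ Poly_Mapping.lookup m i) = (\<Prod>i\<in>?A - {n}. [:a i ^ Poly_Mapping.lookup m i:])"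
      by (rule prod.cong) (auto simp: line_def poly_const_pow)
    also have "\<dots> = [:\<Prod>i\<in>?A - {n}. a i ^ Poly_Mapping.lookup m i:]"
      by (rule const_prod)
    also have "(\<Prod>i\<in>?A - {n}. a i ^ Poly_Mapping.lookup m i) = mono_value a m"
      by (rule prod.mono_neutral_cong) (auto simp: assms in_keys_iff)
    also have "line a n n = [:0, 1:]"
      by (simp add: line_def)
    finally show ?thesis
      by (simp add: monom_altdef)
  qed
  have "coeff (fibre_poly a n p) d = (\<Sum>m\<in>Poly_Mapping.keys p.
      if Poly_Mapping.lookup m n = d then Poly_Mapping.lookup p m * mono_value a m else 0)"
    unfolding insertion_def * by (simp add: coeff_sum if_distrib cong: if_cong)
  also have "\<dots> = (\<Sum>m\<in>{m \<in> Poly_Mapping.keys p. Poly_Mapping.lookup m n = d}. Poly_Mapping.lookup p m * mono_value a m)"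
    by (simp add: sum.inter_filter)
  also have "\<dots> = mpeval a (degree_part n d p)"
    unfolding insertion_def keys_degree_part by (rule sum.cong) (simp_all add: lookup_degree_part)
  finally show ?thesis .
qed

lemma degree_fibre_poly_le:
  assumes "a n = 1" "\<And>m. m \<in> Poly_Mapping.keys p \<Longrightarrow> Poly_Mapping.lookup m n \<le> d"
  shows "degree (fibre_poly a n p) \<le> d"
proof (rule degree_le, intro allI impI)
  fix i assume "d < i"
  then have "degree_part n i p = 0"
    by (intro poly_mapping_eqI) (use assms(2) \<open>d < i\<close> in \<open>force simp: lookup_degree_part in_keys_iff\<close>)
  then show "coeff (fibre_poly a n p) i = 0"
    using coeff_fibre_poly[of a n p i] assms(1) by (simp add: insertion_def[of _ _ 0])
qed

section \<open>Partitions and their rows\<close>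

definition is_partition :: "nat list \<Rightarrow> bool" where
  "is_partition mu \<longleftrightarrow> sorted_wrt (\<ge>) mu \<and> (\<forall>a\<in>set mu. 0 < a)"

lemma partitions_iff: "mu \<in> partitions m \<longleftrightarrow> is_partition mu \<and> sum_list mu = m"
  by (auto simp: partitions_def is_partition_def)

text \<open>Rows past the end are empty rows, so that shapes of different lengths can be compared and
  changed row by row.\<close>

definition row :: "nat list \<Rightarrow> nat \<Rightarrow> nat" where
  "row mu i = (if i < length mu then mu ! i else 0)"

lemma row_antimono: "is_partition mu \<Longrightarrow> i \<le> j \<Longrightarrow> row mu j \<le> row mu i"
  by (cases "i = j") (auto simp: row_def is_partition_def sorted_wrt_iff_nth_less)

lemma row_pos_iff: "is_partition mu \<Longrightarrow> 0 < row mu i \<longleftrightarrow> i < length mu"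
  by (auto simp: row_def is_partition_def)

lemma row_eq_0: "length mu \<le> i \<Longrightarrow> row mu i = 0"
  by (simp add: row_def)

lemma partition_eqI:
  assumes "is_partition mu" "is_partition nu" "\<And>i. row mu i = row nu i"
  shows "mu = nu"
proof (rule nth_equalityI)
  have "i < length mu \<longleftrightarrow> i < length nu" for i
    using assms row_pos_iff by metis
  then show len: "length mu = length nu"
    by (meson linorder_neqE_nat less_irrefl)
  fix i assume "i < length mu"
  then show "mu ! i = nu ! i"
    using assms(3)[of i] len by (simp add: row_def)
qed

lemma ex_partition_with_rows:
  assumes "\<And>i j. i \<le> j \<Longrightarrow> r j \<le> r i" "r k = 0"
  obtains mu where "is_partition mu" "row mu = r"
proof
  define k' where "k' = (LEAST k. r k = 0)"
  have k': "r k' = 0" "\<And>i. i < k' \<Longrightarrow> r i \<noteq> 0"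
    unfolding k'_def using assms(2) by (auto intro: LeastI dest: not_less_Least)
  show "is_partition (map r [0..<k'])"
    using assms(1) k'(2) by (force simp: is_partition_def sorted_wrt_iff_nth_less)
  show "row (map r [0..<k']) = r"
  proof
    fix i
    show "row (map r [0..<k']) i = r i"
      using assms(1)[of k' i] k'(1) by (auto simp: row_def)
  qed
qed

lemma sum_list_take_rows: "sum_list (take k mu) = (\<Sum>i<k. row mu i)"
proof -
  have "sum_list (take k mu) = (\<Sum>i<min (length mu) k. row mu i)"
    by (simp add: sum_list_sum_nth atLeast0LessThan row_def)
  also have "\<dots> = (\<Sum>i<k. row mu i)"
    by (rule sum.mono_neutral_left) (auto simp: row_def)
  finally show ?thesis .
qed

lemma sum_list_rows: "length mu \<le> k \<Longrightarrow> (\<Sum>i<k. row mu i) = sum_list mu"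
  using sum_list_take_rows[of k mu] by simp

lemma sum_rows_le: "(\<Sum>i<k. row mu i) \<le> sum_list mu"
  using sum_list_take_rows[of k mu] by (metis append_take_drop_id le_add1 sum_list_append)

text \<open>For partitions of the same number the comparisons up to \<open>min (length lam) (length mu)\<close> imply all
  others: past the end of \<open>lam\<close> its partial sum is the full sum, and if \<open>mu\<close> ends first, the
  comparison at its end forces the partial sums of \<open>lam\<close> to be full from there on.\<close>

lemma dominated_iff:
  assumes "sum_list mu = sum_list lam" "is_partition mu" "is_partition lam"
  shows "mu \<unlhd> lam \<longleftrightarrow> (\<forall>k. (\<Sum>i<k. row mu i) \<le> (\<Sum>i<k. row lam i))"
proof
  assume dom: "mu \<unlhd> lam"
  show "\<forall>k. (\<Sum>i<k. row mu i) \<le> (\<Sum>i<k. row lam i)"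
  proof
    fix k
    consider "k = 0" | "1 \<le> k" "k \<le> min (length lam) (length mu)" | "length lam \<le> k" | "length mu < k" "k < length lam"
      by linarith
    then show "(\<Sum>i<k. row mu i) \<le> (\<Sum>i<k. row lam i)"
    proof cases
      case 2
      then show ?thesis
        using dom by (simp add: dominated_def sum_list_take_rows)
    next
      case 3
      then show ?thesis
        using sum_rows_le[of mu k] assms(1) by (simp add: sum_list_rows)
    next
      case 4
      have "sum_list (take (length mu) lam) \<ge> sum_list mu"
      proof (cases "mu = []")
        case False
        then have "1 \<le> length mu"
          by (cases mu) auto
        moreover have "length mu \<le> min (length lam) (length mu)"
          using 4 by simp
        ultimately have "sum_list (take (length mu) lam) \<ge> sum_list (take (length mu) mu)"
          using dom unfolding dominated_def by blast
        then show ?thesis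
          by simp
      qed simp
      moreover have "sum_list (take (length mu) lam) \<le> (\<Sum>i<k. row lam i)"
        unfolding sum_list_take_rows using 4 by (intro sum_mono2) auto
      moreover have "(\<Sum>i<k. row mu i) = sum_list mu"
        using 4 by (intro sum_list_rows) simp
      ultimately show ?thesis
        by linarith
    qed simp
  qed
next
  assume "\<forall>k. (\<Sum>i<k. row mu i) \<le> (\<Sum>i<k. row lam i)"
  then show "mu \<unlhd> lam"
    by (simp add: dominated_def sum_list_take_rows)
qed

section \<open>Young diagrams and standard fillings\<close>

lemma in_young_diagram: "(i, j) \<in> young_diagram mu \<longleftrightarrow> j < row mu i"
  by (auto simp: young_diagram_def row_def)

lemma young_diagram_rows: "young_diagram mu = (SIGMA i:{..<length mu}. {..<row mu i})"
  by (auto simp: in_young_diagram row_def split: if_splits)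

lemma finite_young_diagram [simp]: "finite (young_diagram mu)"
  by (simp add: young_diagram_rows)

lemma card_young_diagram: "card (young_diagram mu) = sum_list mu"
  by (simp add: young_diagram_rows card_SigmaI sum_list_rows)

definition height :: "nat list \<Rightarrow> nat \<Rightarrow> nat" where
  "height mu j = card {i. j < row mu i}"

lemma column_cells:
  assumes "is_partition mu"
  shows "{i. j < row mu i} = {..<height mu j}"
proof -
  have fin: "finite {i. j < row mu i}"
    by (rule finite_subset[of _ "{..<length mu}"]) (auto simp: row_def split: if_splits)
  have "\<exists>k. {i. j < row mu i} = {..<k}"
  proof (intro exI)
    let ?k = "LEAST i. \<not> j < row mu i"
    have "\<not> j < row mu ?k"
      by (rule LeastI[of _ "length mu"]) (simp add: row_def)
    then have "i < ?k" if "j < row mu i" for i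
      using row_antimono[OF assms, of ?k i] that by (meson le_trans not_le)
    moreover have "j < row mu i" if "i < ?k" for i
      using not_less_Least[OF that] by simp
    ultimately show "{i. j < row mu i} = {..<?k}"
      by blast
  qed
  then show ?thesis
    unfolding height_def by (metis card_lessThan)
qed

lemma less_height_iff: "is_partition mu \<Longrightarrow> i < height mu j \<longleftrightarrow> j < row mu i"
  using column_cells[of mu j] by blast

lemma column_eq:
  assumes "is_partition mu"
  shows "column mu T j = map (\<lambda>i. T (i, j)) [0..<height mu j]"
proof -
  have le: "height mu j \<le> length mu"
    using less_height_iff[OF assms, of "length mu" j] by (simp add: row_def)
  have "filter (\<lambda>i. (i, j) \<in> young_diagram mu) [0..<k] = [0..<min k (height mu j)]" for k
  proof (induction k)
    case (Suc k)
    then show ?case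
      by (cases "k < height mu j") (auto simp: in_young_diagram less_height_iff[OF assms, symmetric])
  qed simp
  then show ?thesis
    using le by (simp add: column_def min_def)
qed

lemma young_diagram_columns:
  assumes "is_partition mu" "row mu 0 \<le> J"
  shows "young_diagram mu = (\<Union>j<J. (\<lambda>i. (i, j)) ` {..<height mu j})"
proof -
  have "j < J" if "j < row mu i" for i j
    using that row_antimono[OF assms(1), of 0 i] assms(2) by linarith
  then show ?thesis
    by (auto simp: in_young_diagram less_height_iff[OF assms(1)] image_iff)
qed

lemma specht_poly_eq:
  assumes "is_partition mu" "row mu 0 \<le> J"
  shows "specht_poly mu T = (\<Prod>j<J. difference_product (column mu T j))"
proof -
  have "snd ` young_diagram mu = {..<row mu 0}"
  proof (intro equalityI subsetI)
    fix j assume "j \<in> {..<row mu 0}"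
    then have "(0, j) \<in> young_diagram mu"
      by (simp add: in_young_diagram)
    then show "j \<in> snd ` young_diagram mu"
      by force
  next
    fix j assume "j \<in> snd ` young_diagram mu"
    then obtain i where "j < row mu i"
      by (auto simp: in_young_diagram)
    then show "j \<in> {..<row mu 0}"
      using row_antimono[OF assms(1), of 0 i] by simp
  qed
  then have "specht_poly mu T = (\<Prod>j<row mu 0. difference_product (column mu T j))"
    by (simp add: specht_poly_def)
  also have "\<dots> = (\<Prod>j<J. difference_product (column mu T j))"
  proof (rule prod.mono_neutral_left)
    show "\<forall>j\<in>{..<J} - {..<row mu 0}. difference_product (column mu T j) = 1"
    proof
      fix j assume "j \<in> {..<J} - {..<row mu 0}"
      then have "height mu j = 0"
        using less_height_iff[OF assms(1), of 0 j] by auto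
      then show "difference_product (column mu T j) = 1"
        by (simp add: column_eq[OF assms(1)] difference_product_def)
    qed
  qed (use assms(2) in auto)
  finally show ?thesis .
qed

lemma sum_young_diagram_columns:
  assumes "is_partition mu" "row mu 0 \<le> J"
  shows "(\<Sum>x\<in>young_diagram mu. f x) = (\<Sum>j<J. \<Sum>i<height mu j. f (i, j))"
proof -
  have "(\<Sum>x\<in>young_diagram mu. f x) = (\<Sum>(j, i)\<in>(SIGMA j:{..<J}. {..<height mu j}). f (i, j))"
    unfolding young_diagram_columns[OF assms]
    by (rule sum.reindex_bij_witness[where i="\<lambda>(j, i). (i, j)" and j="\<lambda>(i, j). (j, i)"]) auto
  then show ?thesis
    by (simp add: sum.Sigma)
qed

definition specht_monomial :: "nat list \<Rightarrow> (nat \<times> nat \<Rightarrow> nat) \<Rightarrow> monomial" where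
  "specht_monomial mu T = (\<Sum>x\<in>young_diagram mu. Poly_Mapping.single (T x) (fst x))"

text \<open>The conditions of \<^const>\<open>STab\<close> for an arbitrary content \<open>M\<close>. Induction on the number of
  variables passes through the content \<open>1, \<dots>, N\<close>, and the empty one for \<open>N = 0\<close> is not of the
  form occurring in \<^const>\<open>STab\<close> for \<open>l = 1\<close>.\<close>

definition standard_filling :: "nat multiset \<Rightarrow> nat list \<Rightarrow> (nat \<times> nat \<Rightarrow> nat) \<Rightarrow> bool" where
  "standard_filling M mu T \<longleftrightarrow> T \<in> extensional (young_diagram mu) \<and>
     image_mset T (mset_set (young_diagram mu)) = M \<and>
     (\<forall>i i' j. i < i' \<and> (i, j) \<in> young_diagram mu \<and> (i', j) \<in> young_diagram mu \<longrightarrow> T (i, j) < T (i', j)) \<and>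
     (\<forall>i j j'. j < j' \<and> (i, j) \<in> young_diagram mu \<and> (i, j') \<in> young_diagram mu \<longrightarrow> T (i, j) \<le> T (i, j'))"

lemma leading_specht_poly:
  assumes "is_partition mu" "standard_filling M mu T"
  shows "leading (specht_poly mu T) (specht_monomial mu T)"
proof -
  have "leading (difference_product (column mu T j))
      (\<Sum>i<height mu j. Poly_Mapping.single (T (i, j)) i)" for j
  proof -
    have "sorted_wrt (<) (column mu T j)"
      using assms(2) unfolding standard_filling_def column_eq[OF assms(1)]
      by (auto simp: sorted_wrt_iff_nth_less in_young_diagram less_height_iff[OF assms(1), symmetric])
    then have "leading (difference_product (column mu T j))
        (\<Sum>i<length (column mu T j). Poly_Mapping.single (column mu T j ! i) i)"
      by (rule leading_difference_product)
    also have "(\<Sum>i<length (column mu T j). Poly_Mapping.single (column mu T j ! i) i)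
        = (\<Sum>i<height mu j. Poly_Mapping.single (T (i, j)) i)"
      by (rule sum.cong) (auto simp: column_eq[OF assms(1)])
    finally show ?thesis .
  qed
  then show ?thesis
    unfolding specht_poly_eq[OF assms(1) order_refl] specht_monomial_def
      sum_young_diagram_columns[OF assms(1) order_refl]
    by (auto intro: leading_prod)
qed

text \<open>Strictly increasing columns contain the entry \<open>n\<close> at most once.\<close>

lemma STab_eq: "STab n rho l = {T. standard_filling (mset [1..<n] + replicate_mset l n) rho T}"
proof (intro equalityI subsetI)
  fix T assume "T \<in> {T. standard_filling (mset [1..<n] + replicate_mset l n) rho T}"
  then have T: "standard_filling (mset [1..<n] + replicate_mset l n) rho T"
    by simp
  have "i = i'" if "(i, j) \<in> young_diagram rho" "(i', j) \<in> young_diagram rho" "T (i, j) = n" "T (i', j) = n" for i i' j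
    using T that unfolding standard_filling_def by (metis less_irrefl linorder_neqE_nat)
  then show "T \<in> STab n rho l"
    using T unfolding standard_filling_def STab_def Tab_def by auto
qed (auto simp: STab_def Tab_def standard_filling_def)

definition horizontal_strip :: "nat list \<Rightarrow> nat list \<Rightarrow> bool" where
  "horizontal_strip mu rho \<longleftrightarrow> (\<forall>i. row mu i \<le> row rho i \<and> row rho (Suc i) \<le> row mu i)"

text \<open>The new squares receive copies of the new largest entry \<open>N\<close>. The interlacing condition puts at
  most one of them into each column, below all old squares, so that the filling remains standard;
  a new square in row \<open>i\<close> contributes \<open>i\<close> to the exponent of \<open>x\<^sub>N\<close>.\<close>

lemma standard_filling_extend:
  assumes "is_partition mu" "is_partition rho" "standard_filling M mu T"
    and hs: "horizontal_strip mu rho"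
    and less: "\<And>x. x \<in># M \<Longrightarrow> x < N"
  shows "\<exists>T'. standard_filling (M + replicate_mset (sum_list rho - sum_list mu) N) rho T' \<and>
    specht_monomial rho T' = specht_monomial mu T + Poly_Mapping.single N (\<Sum>i<length rho. i * (row rho i - row mu i))"
proof -
  let ?S = "young_diagram rho - young_diagram mu"
  have le: "row mu i \<le> row rho i" and strip: "row rho (Suc i) \<le> row mu i" for i
    using hs by (simp_all add: horizontal_strip_def)
  define T' where "T' = restrict (\<lambda>x. if x \<in> young_diagram mu then T x else N) (young_diagram rho)"
  have sub: "young_diagram mu \<subseteq> young_diagram rho"
    using less_le_trans[OF _ le] by (auto simp: in_young_diagram)
  have T'_mu: "T' x = T x" if "x \<in> young_diagram mu" for x
    using that sub by (auto simp: T'_def)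
  have T'_S: "T' x = N" if "x \<in> ?S" for x
    using that by (auto simp: T'_def)
  have M: "image_mset T (mset_set (young_diagram mu)) = M"
    using assms(3) by (simp add: standard_filling_def)
  have T_less: "T x < N" if "x \<in> young_diagram mu" for x
  proof -
    have "T x \<in># M"
      unfolding M[symmetric] using that by simp
    then show ?thesis
      by (rule less)
  qed
  have split: "young_diagram rho = young_diagram mu \<union> ?S"
    using sub by blast
  have above: "(i, j) \<in> young_diagram mu" if "i < i'" "(i', j) \<in> young_diagram rho" for i i' j
  proof -
    have "j < row rho i'"
      using that by (simp add: in_young_diagram)
    also have "\<dots> \<le> row rho (Suc i)"
      using row_antimono[OF assms(2)] that by simp
    also have "\<dots> \<le> row mu i"
      by (rule strip)
    finally show ?thesis
      by (simp add: in_young_diagram)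
  qed
  have "mset_set (young_diagram rho) = mset_set (young_diagram mu) + mset_set ?S"
    by (subst split, rule mset_set_Union) auto
  then have "image_mset T' (mset_set (young_diagram rho)) =
      image_mset T' (mset_set (young_diagram mu)) + image_mset T' (mset_set ?S)"
    by simp
  also have "image_mset T' (mset_set (young_diagram mu)) = M"
    unfolding M[symmetric] by (rule image_mset_cong) (simp add: T'_mu)
  also have "image_mset T' (mset_set ?S) = image_mset (\<lambda>_. N) (mset_set ?S)"
    by (rule image_mset_cong) (simp add: T'_S)
  also have "\<dots> = replicate_mset (sum_list rho - sum_list mu) N"
    using card_Diff_subset[OF finite_young_diagram sub] by (simp add: image_mset_const_eq card_young_diagram)
  finally have content: "image_mset T' (mset_set (young_diagram rho)) = M + replicate_mset (sum_list rho - sum_list mu) N" .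
  have "T' (i, j) < T' (i', j)" if "i < i'" "(i', j) \<in> young_diagram rho" for i i' j
  proof (cases "(i', j) \<in> young_diagram mu")
    case True
    then show ?thesis
      using above[OF that] T'_mu assms(3) that(1) unfolding standard_filling_def by metis
  next
    case False
    then have "T' (i', j) = N"
      using T'_S that(2) by blast
    then show ?thesis
      using above[OF that] T'_mu T_less by metis
  qed
  moreover have "T' (i, j) \<le> T' (i, j')" if "j < j'" "(i, j') \<in> young_diagram rho" for i j j'
  proof (cases "(i, j') \<in> young_diagram mu")
    case True
    then have "(i, j) \<in> young_diagram mu"
      using that(1) by (auto simp: in_young_diagram)
    then show ?thesis
      using True T'_mu assms(3) that(1) unfolding standard_filling_def by metis
  next
    case False
    have "T' x \<le> N" if "x \<in> young_diagram rho" for x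
      using that T'_S[of x] T'_mu[of x] T_less[of x] by fastforce
    moreover have "(i, j) \<in> young_diagram rho"
      using that by (auto simp: in_young_diagram)
    ultimately show ?thesis
      using False T'_S[of "(i, j')"] that(2) by auto
  qed
  moreover have "T' \<in> extensional (young_diagram rho)"
    by (simp add: T'_def)
  ultimately have std: "standard_filling (M + replicate_mset (sum_list rho - sum_list mu) N) rho T'"
    unfolding standard_filling_def using content by blast
  have "specht_monomial rho T' = (\<Sum>x\<in>young_diagram mu. Poly_Mapping.single (T' x) (fst x))
      + (\<Sum>x\<in>?S. Poly_Mapping.single (T' x) (fst x))"
    unfolding specht_monomial_def by (subst split, rule sum.union_disjoint) auto
  also have "(\<Sum>x\<in>young_diagram mu. Poly_Mapping.single (T' x) (fst x)) = specht_monomial mu T"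
    unfolding specht_monomial_def by (rule sum.cong) (auto simp: T'_mu)
  also have "(\<Sum>x\<in>?S. Poly_Mapping.single (T' x) (fst x)) = (\<Sum>x\<in>?S. Poly_Mapping.single N (fst x))"
    by (rule sum.cong) (auto simp: T'_S)
  also have "\<dots> = Poly_Mapping.single N (\<Sum>x\<in>?S. fst x)"
    by (rule poly_mapping_eqI) (simp add: lookup_sum lookup_single when_def)
  also have "(\<Sum>x\<in>?S. fst x) = (\<Sum>i<length rho. i * (row rho i - row mu i))"
  proof -
    have "?S = (SIGMA i:{..<length rho}. {row mu i..<row rho i})"
      by (auto simp: in_young_diagram row_def split: if_splits)
    then have "(\<Sum>x\<in>?S. fst x) = (\<Sum>i<length rho. \<Sum>j\<in>{row mu i..<row rho i}. i)"
      by (subst sum.Sigma) (auto simp: case_prod_unfold)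
    then show ?thesis
      by (simp add: mult.commute)
  qed
  finally show ?thesis
    using std by blast
qed

section \<open>An exchange identity for difference products\<close>

text \<open>The difference product over an arbitrary commutative ring, as a list recursion.\<close>

primrec vandermonde :: "'a::comm_ring_1 list \<Rightarrow> 'a" where
  "vandermonde [] = 1"
| "vandermonde (x # xs) = (\<Prod>y\<leftarrow>xs. x - y) * vandermonde xs"

definition delete_nth :: "nat \<Rightarrow> 'a list \<Rightarrow> 'a list" where
  "delete_nth k xs = take k xs @ drop (Suc k) xs"

lemma delete_nth_0 [simp]: "delete_nth 0 (y # ys) = ys"
  by (simp add: delete_nth_def)

lemma delete_nth_Suc [simp]: "delete_nth (Suc k) (y # ys) = y # delete_nth k ys"
  by (simp add: delete_nth_def)

lemma map_delete_nth: "map f (delete_nth k xs) = delete_nth k (map f xs)"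
  by (simp add: delete_nth_def take_map drop_map)

lemma prod_list_delete_nth:
  fixes f :: "'a \<Rightarrow> 'b::comm_monoid_mult"
  assumes "k < length xs"
  shows "f (xs ! k) * (\<Prod>y\<leftarrow>delete_nth k xs. f y) = (\<Prod>y\<leftarrow>xs. f y)"
proof -
  have "(\<Prod>y\<leftarrow>xs. f y) = (\<Prod>y\<leftarrow>take k xs @ xs ! k # drop (Suc k) xs. f y)"
    using id_take_nth_drop[OF assms] by simp
  then show ?thesis
    by (simp add: delete_nth_def mult_ac)
qed

lemma vandermonde_snoc: "vandermonde (xs @ [z]) = vandermonde xs * (\<Prod>x\<leftarrow>xs. x - z)"
  by (induction xs) (simp_all add: mult_ac)

lemma vandermonde_not_distinct: "\<not> distinct xs \<Longrightarrow> vandermonde xs = (0 :: 'a::idom)"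
  by (induction xs) (auto simp: prod_list_zero_iff)

lemma degree_prod_linear_factors:
  fixes ys :: "'a::idom list"
  shows "degree (\<Prod>y\<leftarrow>ys. [:-y, 1:]) = length ys \<and> lead_coeff (\<Prod>y\<leftarrow>ys. [:-y, 1:]) = 1"
proof (induction ys)
  case (Cons z zs)
  have nz: "(\<Prod>w\<leftarrow>zs. [:-w, 1:]) \<noteq> 0"
    by (auto simp: prod_list_zero_iff)
  have eq: "(\<Prod>w\<leftarrow>z # zs. [:-w, 1:]) = [:-z, 1:] * (\<Prod>w\<leftarrow>zs. [:-w, 1:])"
    by simp
  have "degree (\<Prod>w\<leftarrow>z # zs. [:-w, 1:]) = length (z # zs)"
    unfolding eq using Cons.IH degree_mult_eq[of "[:-z, 1:]", OF _ nz] by simp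
  moreover have "lead_coeff (\<Prod>w\<leftarrow>z # zs. [:-w, 1:]) = 1"
    unfolding eq lead_coeff_mult using Cons.IH by auto
  ultimately show ?case
    by blast
qed simp

text \<open>Laplace expansion of the Vandermonde determinant along a column holding the values of \<open>p\<close>:
  only the coefficient of \<open>p\<close> in the top degree survives, since the lower powers repeat one of the
  other columns. The proof is by induction on the list \<open>y # ys\<close>. For multiples of \<open>x - y\<close> the
  expansion reduces to that of \<open>ys\<close>, so only \<open>p = 1\<close> remains, and this case is read off from the
  polynomial with root set \<open>ys\<close>, for which a single summand is nonzero.\<close>

lemma vandermonde_expansion:
  fixes p :: "'a::idom poly"
  assumes "distinct xs" "degree p < length xs"
  shows "(\<Sum>k<length xs. (-1) ^ k * poly p (xs ! k) * vandermonde (delete_nth k xs))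
     = coeff p (length xs - 1) * vandermonde xs"
  using assms
proof (induction xs arbitrary: p)
  case (Cons y ys)
  define S where "S p = (\<Sum>k<length (y # ys). (-1) ^ k * poly p ((y # ys) ! k) * vandermonde (delete_nth k (y # ys)))" for p
  have S_add: "S (p + q) = S p + S q" for p q
    by (simp add: S_def algebra_simps sum.distrib del: sum.lessThan_Suc)
  have S_smult: "S (smult c p) = c * S p" for c p
    by (simp add: S_def sum_distrib_left algebra_simps del: sum.lessThan_Suc)
  have S_eq: "S p = poly p y * vandermonde ys - (\<Sum>k<length ys. (-1) ^ k * poly p (ys ! k) *
      ((\<Prod>w\<leftarrow>delete_nth k ys. y - w) * vandermonde (delete_nth k ys)))" for p
    unfolding S_def by (simp add: sum.lessThan_Suc_shift sum_negf del: sum.lessThan_Suc)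
  have S_factor: "S ([:-y, 1:] * q) = coeff q (length ys - 1) * vandermonde (y # ys)" if "degree q < length ys" for q
  proof -
    have "(-1) ^ k * poly ([:-y, 1:] * q) (ys ! k) * ((\<Prod>w\<leftarrow>delete_nth k ys. y - w) * vandermonde (delete_nth k ys))
        = - (\<Prod>w\<leftarrow>ys. y - w) * ((-1) ^ k * poly q (ys ! k) * vandermonde (delete_nth k ys))" if "k < length ys" for k
    proof -
      have *: "(\<Prod>w\<leftarrow>ys. y - w) = (y - ys ! k) * (\<Prod>w\<leftarrow>delete_nth k ys. y - w)"
        using prod_list_delete_nth[OF that, of "\<lambda>w. y - w"] by simp
      show ?thesis
        unfolding * poly_mult by (simp add: left_diff_distrib right_diff_distrib mult_ac)
    qed
    then have "S ([:-y, 1:] * q) = (\<Prod>w\<leftarrow>ys. y - w) *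
        (\<Sum>k<length ys. (-1) ^ k * poly q (ys ! k) * vandermonde (delete_nth k ys))"
      unfolding S_eq by (simp add: sum_distrib_left sum_negf)
    also have "\<dots> = (\<Prod>w\<leftarrow>ys. y - w) * (coeff q (length ys - 1) * vandermonde ys)"
      using Cons.IH[of q] Cons.prems(1) that by simp
    finally show ?thesis
      by simp
  qed
  show ?case
  proof (cases "ys = []")
    case True
    then obtain c where "p = [:c:]"
      using Cons.prems(2) degree_eq_zeroE[of p] by auto
    then show ?thesis
      by (simp add: True)
  next
    case False
    have decompose: "\<exists>q. p = [:-y, 1:] * q + smult (poly p y) 1 \<and> degree q < length ys \<and>
        coeff q (length ys - 1) = coeff p (length ys)" if "degree p \<le> length ys" for p
    proof -
      let ?q = "synthetic_div p y"
      have p: "p = [:-y, 1:] * ?q + [:poly p y:]"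
        using synthetic_div_correct'[of y p] by simp
      have deg: "degree ?q < length ys"
        using that False by (cases ys) (auto simp: degree_synthetic_div)
      obtain k where k: "length ys = Suc k"
        using False by (cases ys) auto
      have "coeff ?q (Suc k) = 0"
        using deg k by (intro coeff_eq_0) simp
      then have "coeff ([:-y, 1:] * ?q + [:poly p y:]) (Suc k) = coeff ?q k"
        by simp
      moreover have "coeff p (Suc k) = coeff ([:-y, 1:] * ?q + [:poly p y:]) (Suc k)"
        using p by (rule arg_cong)
      ultimately have "coeff ?q (length ys - 1) = coeff p (length ys)"
        using k by simp
      moreover have "p = [:-y, 1:] * ?q + smult (poly p y) 1"
        using p by (simp add: one_pCons)
      ultimately show ?thesis
        using deg by blast
    qed
    have "S 1 = 0"
    proof -
      define g where "g = (\<Prod>w\<leftarrow>ys. [:-w, 1:])"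
      have g: "degree g = length ys" "coeff g (length ys) = 1"
      proof -
        show "degree g = length ys" "coeff g (length ys) = 1"
          using degree_prod_linear_factors[of ys] by (auto simp: g_def)
      qed
      have poly_g: "poly g x = (\<Prod>w\<leftarrow>ys. x - w)" for x
        unfolding g_def by (induction ys) (auto simp: algebra_simps)
      have "S g = poly g y * vandermonde ys"
        unfolding S_eq by (auto simp: poly_g prod_list_zero_iff intro!: sum.neutral)
      also have "\<dots> = vandermonde (y # ys)"
        by (simp add: poly_g)
      finally have Sg: "S g = vandermonde (y # ys)" .
      obtain q where q: "g = [:-y, 1:] * q + smult (poly g y) 1" "degree q < length ys"
          "coeff q (length ys - 1) = 1"
        using decompose[of g] g by auto
      have "S g = vandermonde (y # ys) + poly g y * S 1"
        using arg_cong[OF q(1), of S] by (simp only: S_add S_smult S_factor[OF q(2)] q(3) mult_1_left)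
      with Sg have "poly g y * S 1 = 0"
        by simp
      moreover have "poly g y \<noteq> 0"
        using Cons.prems(1) by (auto simp: poly_g prod_list_zero_iff)
      ultimately show ?thesis
        by simp
    qed
    obtain q where q: "p = [:-y, 1:] * q + smult (poly p y) 1" "degree q < length ys"
        "coeff q (length ys - 1) = coeff p (length ys)"
      using decompose[of p] Cons.prems(2) by auto
    have "S p = coeff p (length ys) * vandermonde (y # ys)"
      using arg_cong[OF q(1), of S]
      by (simp only: S_add S_smult S_factor[OF q(2)] q(3) \<open>S 1 = 0\<close> mult_zero_right add_0_right)
    then show ?thesis
      by (simp add: S_def)
  qed
qed simp

text \<open>Apply the expansion to the monic polynomial
  \<open>x ^ (length xs - 1 - length ys) * (\<Prod>y\<leftarrow>ys. x - y)\<close>, whose second factor turns the difference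
  product of \<open>ys\<close> into that of \<open>ys @ [x]\<close> up to sign.\<close>

lemma vandermonde_exchange:
  fixes xs ys :: "'a::idom list"
  assumes "distinct xs" "length ys < length xs"
  shows "vandermonde xs * vandermonde ys = (\<Sum>k<length xs.
    (-1) ^ k * (-1) ^ length ys * (xs ! k) ^ (length xs - 1 - length ys) *
    (vandermonde (delete_nth k xs) * vandermonde (ys @ [xs ! k])))"
proof -
  define p where "p = monom 1 (length xs - 1 - length ys) * (\<Prod>y\<leftarrow>ys. [:-y, 1:])"
  have nz: "(\<Prod>y\<leftarrow>ys. [:-y, 1:]) \<noteq> 0"
    by (auto simp: prod_list_zero_iff)
  have deg: "degree p = length xs - 1"
    using assms(2) nz degree_prod_linear_factors[of ys] by (auto simp: p_def degree_mult_eq degree_monom_eq)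
  have lead: "lead_coeff p = 1"
    unfolding p_def lead_coeff_mult using degree_prod_linear_factors[of ys] by (auto simp: degree_monom_eq)
  have "(\<Prod>y\<leftarrow>ys. y - x) = (-1) ^ length ys * (\<Prod>y\<leftarrow>ys. x - y)" for x
    by (induction ys) (auto simp: algebra_simps)
  moreover have "poly p x = x ^ (length xs - 1 - length ys) * (\<Prod>y\<leftarrow>ys. x - y)" for x
  proof -
    have "poly (\<Prod>y\<leftarrow>ys. [:-y, 1:]) x = (\<Prod>y\<leftarrow>ys. x - y)"
      by (induction ys) (auto simp: algebra_simps)
    then show ?thesis
      by (simp add: p_def poly_monom)
  qed
  ultimately have "(-1) ^ k * poly p (xs ! k) * vandermonde (delete_nth k xs) * vandermonde ys =
    (-1) ^ k * (-1) ^ length ys * (xs ! k) ^ (length xs - 1 - length ys) *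
    (vandermonde (delete_nth k xs) * vandermonde (ys @ [xs ! k]))" for k
    by (simp add: vandermonde_snoc mult_ac)
  note term_eq = this
  have "vandermonde xs * vandermonde ys =
      (\<Sum>k<length xs. (-1) ^ k * poly p (xs ! k) * vandermonde (delete_nth k xs) * vandermonde ys)"
    using vandermonde_expansion[OF assms(1), of p] deg lead assms(2)
    by (simp add: sum_distrib_right[symmetric])
  then show ?thesis
    by (simp only: term_eq)
qed

lemma difference_product_eq_vandermonde:
  "difference_product a = (vandermonde (map X a) :: 'k::field mpoly)"
proof (induction a)
  case Nil
  then show ?case
    by (simp add: difference_product_def)
next
  case (Cons x xs)
  let ?P = "{(i, j). i < j \<and> j < length xs}" and ?Q = "{(i, j). i < j \<and> j < length (x # xs)}"
  have fin: "finite ?P"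
    by (rule finite_subset[of _ "{..<length xs} \<times> {..<length xs}"]) auto
  have "?Q = (\<lambda>j. (0, Suc j)) ` {..<length xs} \<union> (\<lambda>(i, j). (Suc i, Suc j)) ` ?P"
  proof (intro equalityI subsetI)
    fix z assume "z \<in> ?Q"
    then obtain i j where z: "z = (i, j)" "i < j" "j < Suc (length xs)"
      by auto
    then obtain j' where j': "j = Suc j'"
      by (cases j) auto
    show "z \<in> (\<lambda>j. (0, Suc j)) ` {..<length xs} \<union> (\<lambda>(i, j). (Suc i, Suc j)) ` ?P"
      using z j' by (cases i) force+
  qed auto
  then have "(difference_product (x # xs) :: 'k mpoly) =
      (\<Prod>(i, j)\<in>(\<lambda>j. (0, Suc j)) ` {..<length xs} \<union> (\<lambda>(i, j). (Suc i, Suc j)) ` ?P. X ((x # xs) ! i) - X ((x # xs) ! j))"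
    by (simp add: difference_product_def)
  also have "\<dots> = (\<Prod>(i, j)\<in>(\<lambda>j. (0, Suc j)) ` {..<length xs}. X ((x # xs) ! i) - X ((x # xs) ! j)) *
      (\<Prod>(i, j)\<in>(\<lambda>(i, j). (Suc i, Suc j)) ` ?P. X ((x # xs) ! i) - X ((x # xs) ! j))"
    by (rule prod.union_disjoint) (use fin in auto)
  also have "(\<Prod>(i, j)\<in>(\<lambda>j. (0, Suc j)) ` {..<length xs}. X ((x # xs) ! i) - X ((x # xs) ! j))
      = (\<Prod>j<length xs. X x - X (xs ! j))"
    by (subst prod.reindex) (auto simp: inj_on_def)
  also have "\<dots> = (\<Prod>y\<leftarrow>map X xs. X x - y)"
    by (simp add: prod.list_conv_set_nth atLeast0LessThan)
  also have "(\<Prod>(i, j)\<in>(\<lambda>(i, j). (Suc i, Suc j)) ` ?P. X ((x # xs) ! i) - X ((x # xs) ! j)) = difference_product xs"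
    unfolding difference_product_def
    by (subst prod.reindex) (auto simp: inj_on_def case_prod_unfold)
  finally show ?case
    using Cons.IH by simp
qed

lemma keys_X: "Poly_Mapping.keys (X i) = {Poly_Mapping.single i 1}"
  by (simp add: X_def monom_poly_def)

lemma X_inject: "X a = (X b :: 'k::field mpoly) \<longleftrightarrow> a = b"
proof
  assume "X a = (X b :: 'k mpoly)"
  then have "Poly_Mapping.keys (X a :: 'k mpoly) = Poly_Mapping.keys (X b :: 'k mpoly)"
    by (rule arg_cong)
  then have "Poly_Mapping.single a (1::nat) = Poly_Mapping.single b 1"
    unfolding keys_X by (simp only: singleton_inject)
  then have "Poly_Mapping.keys (Poly_Mapping.single a (1::nat)) = Poly_Mapping.keys (Poly_Mapping.single b (1::nat))"
    by (rule arg_cong)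
  then show "a = b"
    by simp
qed simp

lemma difference_product_exchange:
  assumes "distinct xs" "length ys < length xs"
  shows "difference_product xs * difference_product ys = (\<Sum>k<length xs.
    (-1) ^ k * (-1) ^ length ys * X (xs ! k) ^ (length xs - 1 - length ys) *
    (difference_product (delete_nth k xs) * (difference_product (ys @ [xs ! k]) :: 'k::field mpoly)))"
proof -
  have "distinct (map X xs :: 'k mpoly list)"
    using assms(1) by (simp add: distinct_map inj_on_def X_inject)
  from vandermonde_exchange[OF this, of "map X ys"] show ?thesis
    using assms(2) by (simp add: difference_product_eq_vandermonde map_delete_nth)
qed

lemma difference_product_not_distinct: "\<not> distinct xs \<Longrightarrow> difference_product xs = 0"
  by (simp add: difference_product_eq_vandermonde vandermonde_not_distinct distinct_map)

section \<open>Specht ideals and dominance\<close>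

text \<open>Fillings with the right content whose columns may repeat an entry. Moving entries between
  columns can produce repetitions, but then the Specht polynomial is zero.\<close>

definition filling :: "nat multiset \<Rightarrow> nat list \<Rightarrow> (nat \<times> nat \<Rightarrow> nat) \<Rightarrow> bool" where
  "filling M mu T \<longleftrightarrow> image_mset T (mset_set (young_diagram mu)) = M"

lemma filling_entry: "filling M mu T \<Longrightarrow> x \<in> young_diagram mu \<Longrightarrow> T x \<in># M"
  by (auto simp: filling_def)

lemma specht_poly_repeated:
  assumes "is_partition mu" "\<not> distinct (column mu T j)"
  shows "specht_poly mu T = 0"
proof -
  have "j < Suc j" "row mu 0 \<le> max (row mu 0) (Suc j)"
    by auto
  then show ?thesis
    using difference_product_not_distinct[OF assms(2)]
    by (subst specht_poly_eq[OF assms(1), of "max (row mu 0) (Suc j)"]) (auto intro!: prod_zero bexI[of _ j])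
qed

lemma specht_poly_in_specht_ideal:
  assumes "is_partition lam" "filling (mset [1..<n] + replicate_mset l n) lam T"
  shows "specht_poly lam T \<in> specht_ideal n lam l"
proof (cases "\<forall>j. distinct (column lam T j)")
  case True
  define T' where "T' = restrict T (young_diagram lam)"
  have "image_mset T' (mset_set (young_diagram lam)) = image_mset T (mset_set (young_diagram lam))"
    by (rule image_mset_cong) (simp add: T'_def)
  moreover have "i = i'" if "(i, j) \<in> young_diagram lam" "(i', j) \<in> young_diagram lam"
      "T' (i, j) = n" "T' (i', j) = n" for i i' j
    using True[rule_format, of j] that
    by (auto simp: T'_def column_eq[OF assms(1)] distinct_map in_young_diagram less_height_iff[OF assms(1), symmetric] inj_on_def)
  ultimately have "T' \<in> Tab n lam l"
    using assms(2) unfolding Tab_def filling_def by (auto simp: T'_def)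
  moreover have "specht_poly lam T = specht_poly lam T'"
    unfolding specht_poly_def
    by (intro prod.cong arg_cong[of _ _ difference_product])
      (auto simp: column_eq[OF assms(1)] T'_def in_young_diagram less_height_iff[OF assms(1), symmetric])
  ultimately show ?thesis
    unfolding specht_ideal_def by (auto intro: generator_in_ideal_gen)
next
  case False
  then show ?thesis
    using specht_poly_repeated[OF assms(1)] zero_in_ideal_gen unfolding specht_ideal_def by metis
qed

lemma nat_eqI_less: "(\<And>k. k < a \<longleftrightarrow> k < (b::nat)) \<Longrightarrow> a = b"
  by (meson linorder_neqE_nat less_irrefl)

text \<open>Moving the last square of row \<open>j\<close> up to the end of row \<open>i\<close> shortens a column from \<open>j + 1\<close> to \<open>j\<close>
  squares and lengthens another one from \<open>i\<close> to \<open>i + 1\<close>. The exchange identity for these two columns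
  writes the old Specht polynomial as a combination of new ones, one for each entry \<open>x\<close> of the long
  column that can be moved.\<close>

lemma move_box:
  fixes I :: "'k::field mpoly set"
  assumes rho: "is_partition rho" "is_partition rho'" "sum_list rho = sum_list rho'"
    and ij: "i < j" and rows: "row rho' = (row rho)(i := row rho i + 1, j := row rho j - 1)" "0 < row rho j"
    and I: "I = ideal_gen n G" and M: "set_mset M \<subseteq> {1..n}" "filling M rho T"
    and IH: "\<And>T'. filling M rho' T' \<Longrightarrow> specht_poly rho' T' \<in> I"
  shows "specht_poly rho T \<in> I"
proof -
  define c where "c = row rho j - 1"
  define c' where "c' = row rho i"
  have "row rho j \<le> row rho i"
    using row_antimono[OF rho(1)] ij by simp
  then have cc': "c < c'"
    using rows(2) by (simp add: c_def c'_def)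
  have row_c': "row rho k \<le> c' \<longleftrightarrow> i \<le> k" for k
  proof
    assume *: "row rho k \<le> c'"
    show "i \<le> k"
    proof (rule ccontr)
      assume "\<not> i \<le> k"
      then have "row rho' i \<le> row rho' k" "k \<noteq> i" "k \<noteq> j"
        using row_antimono[OF rho(2), of k i] ij by auto
      then show False
        using * ij by (simp add: rows(1) c'_def)
    qed
  qed (simp add: c'_def row_antimono[OF rho(1)])
  have row_c: "c < row rho k \<longleftrightarrow> k \<le> j" for k
  proof
    assume *: "c < row rho k"
    show "k \<le> j"
    proof (rule ccontr)
      assume "\<not> k \<le> j"
      then have "row rho' k \<le> row rho' j" "k \<noteq> i" "k \<noteq> j"
        using row_antimono[OF rho(2), of j k] ij by auto
      then show False
        using * ij by (simp add: rows(1) c_def)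
    qed
  next
    assume "k \<le> j"
    then show "c < row rho k"
      using row_antimono[OF rho(1), of k j] rows(2) by (simp add: c_def)
  qed
  have height_c: "height rho c = Suc j"
    by (rule nat_eqI_less) (auto simp: less_height_iff[OF rho(1)] row_c)
  have height_c': "height rho c' = i"
  proof (rule nat_eqI_less)
    fix k
    show "k < height rho c' \<longleftrightarrow> k < i"
      using row_c'[of k] less_height_iff[OF rho(1), of k c'] not_le by blast
  qed
  have height'_c: "height rho' c = j"
  proof (rule nat_eqI_less)
    fix k
    have "c < row rho' k \<longleftrightarrow> k < j"
    proof (cases "k = i \<or> k = j")
      case True
      then show ?thesis
        using cc' ij by (auto simp: rows(1) c_def c'_def)
    next
      case False
      then show ?thesis
        using row_c[of k] by (auto simp: rows(1))
    qed
    then show "k < height rho' c \<longleftrightarrow> k < j"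
      by (simp add: less_height_iff[OF rho(2)])
  qed
  have height'_c': "height rho' c' = Suc i"
  proof (rule nat_eqI_less)
    fix k
    show "k < height rho' c' \<longleftrightarrow> k < Suc i"
      using row_c'[of k] cc' ij unfolding less_height_iff[OF rho(2)] rows(1)
      by (auto simp: c'_def c_def)
  qed
  have height_other: "height rho' k = height rho k" if "k \<noteq> c" "k \<noteq> c'" for k
  proof (rule nat_eqI_less)
    fix r
    show "r < height rho' k \<longleftrightarrow> r < height rho k"
      using that ij rows(2) unfolding less_height_iff[OF rho(1)] less_height_iff[OF rho(2)] rows(1)
      by (auto simp: c'_def c_def)
  qed
  show ?thesis
  proof (cases "distinct (column rho T c)")
    case False
    then show ?thesis
      using specht_poly_repeated[OF rho(1)] zero_in_ideal_gen unfolding I by metis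
  next
    case distinct: True
    let ?D = "difference_product :: nat list \<Rightarrow> 'k mpoly"
    define A where "A = column rho T c"
    define B where "B = column rho T c'"
    have len: "length A = Suc j" "length B = i"
      by (simp_all add: A_def B_def column_eq[OF rho(1)] height_c height_c')
    \<comment> \<open>the square of the old diagram whose entry goes to the square \<open>z\<close> of the new one when the
      entry in row \<open>x\<close> of column \<open>c\<close> is moved\<close>
    define phi where "phi x z = (if snd z = c then (if fst z < x then z else (Suc (fst z), c))
        else if z = (i, c') then (x, c) else z)" for x z
    \<comment> \<open>one column more than \<open>rho\<close> has, as column \<open>c'\<close> may be new\<close>
    define J where "J = Suc (row rho 0)"
    have J: "row rho 0 \<le> J" "row rho' 0 \<le> J"
      using rows ij by (auto simp: J_def)
    define R where "R = (\<Prod>k\<in>{..<J} - {c, c'}. ?D (column rho T k))"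
    have "c' < J"
      using row_antimono[OF rho(1), of 0 i] by (simp add: J_def c'_def)
    then have split: "(\<Prod>k<J. f k) = f c * f c' * (\<Prod>k\<in>{..<J} - {c, c'}. f k)" for f :: "nat \<Rightarrow> 'k mpoly"
    proof -
      have "(\<Prod>k<J. f k) = f c * (\<Prod>k\<in>{..<J} - {c}. f k)"
        using \<open>c' < J\<close> cc' by (intro prod.remove) auto
      also have "(\<Prod>k\<in>{..<J} - {c}. f k) = f c' * (\<Prod>k\<in>{..<J} - {c} - {c'}. f k)"
        using \<open>c' < J\<close> cc' by (intro prod.remove) auto
      also have "{..<J} - {c} - {c'} = {..<J} - {c, c'}"
        by auto
      finally show ?thesis
        by (simp add: mult.assoc)
    qed
    have T': "filling M rho' (T \<circ> phi x)" 
         "specht_poly rho' (T \<circ> phi x) = ?D (delete_nth x A) * ?D (B @ [A ! x]) * R" if "x \<le> j" for x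
    proof -
      have phi_in: "phi x z \<in> young_diagram rho" if "z \<in> young_diagram rho'" for z
      proof (cases z)
        case (Pair r k)
        then have "r < height rho' k"
          using that by (simp add: in_young_diagram less_height_iff[OF rho(2)])
        then show ?thesis
          using \<open>x \<le> j\<close> cc' height_c height_c' height'_c height'_c' height_other[of k] Pair
          by (cases "k = c'") (auto simp: phi_def in_young_diagram less_height_iff[OF rho(1), symmetric] less_Suc_eq)
      qed
      have inj: "inj_on (phi x) (young_diagram rho')"
        using cc' by (auto simp: inj_on_def phi_def split: if_splits)
      have "phi x ` young_diagram rho' = young_diagram rho"
        by (rule card_subset_eq) (use phi_in inj rho(3) in \<open>auto simp: card_image card_young_diagram\<close>)
      then have "mset_set (young_diagram rho) = image_mset (phi x) (mset_set (young_diagram rho'))"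
        using image_mset_mset_set[OF inj] by simp
      then show "filling M rho' (T \<circ> phi x)"
        using M(2) by (simp add: filling_def multiset.map_comp)
      have "column rho' (T \<circ> phi x) c = delete_nth x A"
      proof (rule nth_equalityI)
        show "length (column rho' (T \<circ> phi x) c) = length (delete_nth x A)"
          using that len by (simp add: column_eq[OF rho(2)] height'_c delete_nth_def)
        fix r assume "r < length (column rho' (T \<circ> phi x) c)"
        then have "r < j"
          by (simp add: column_eq[OF rho(2)] height'_c)
        then show "column rho' (T \<circ> phi x) c ! r = delete_nth x A ! r"
          using that len(1)
          by (auto simp: column_eq[OF rho(2)] height'_c delete_nth_def nth_append phi_def min_def)
            (auto simp: A_def column_eq[OF rho(1)] height_c simp del: upt_Suc)
      qed
      moreover have "column rho' (T \<circ> phi x) c' = B @ [A ! x]"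
        using cc' that
        by (auto simp: column_eq[OF rho(2)] column_eq[OF rho(1)] height'_c' height_c' height_c A_def B_def phi_def simp del: upt_Suc)
          (auto simp: upt_Suc_append nth_append)
      moreover have "column rho' (T \<circ> phi x) k = column rho T k" if "k \<noteq> c" "k \<noteq> c'" for k
        using that by (auto simp: column_eq[OF rho(2)] column_eq[OF rho(1)] height_other phi_def)
      ultimately show "specht_poly rho' (T \<circ> phi x) = ?D (delete_nth x A) * ?D (B @ [A ! x]) * R"
        unfolding specht_poly_eq[OF rho(2) J(2)] split R_def by simp
    qed
    have "specht_poly rho T = ?D A * ?D B * R"
      unfolding specht_poly_eq[OF rho(1) J(1)] split R_def A_def B_def by simp
    also have "\<dots> = (\<Sum>k<length A. ((-1) ^ k * (-1) ^ length B * X (A ! k) ^ (length A - 1 - length B)) *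
        specht_poly rho' (T \<circ> phi k))"
      unfolding difference_product_exchange[OF distinct[folded A_def], of B, unfolded len, OF less_SucI[OF ij]]
        sum_distrib_right len
      by (rule sum.cong) (auto simp: T'(2) mult.assoc)
    also have "\<dots> \<in> I"
      unfolding I
    proof (intro ideal_gen_sum ideal_gen_mult)
      fix k assume k: "k \<in> {..<length A}"
      then show "specht_poly rho' (T \<circ> phi k) \<in> ideal_gen n G"
        using IH[OF T'(1)] len I by simp
      have "A ! k = T (k, c)" "k < Suc j"
        using k len by (auto simp: A_def column_eq[OF rho(1)] height_c simp del: upt_Suc)
      then have "A ! k \<in># M"
        using filling_entry[OF M(2), of "(k, c)"] row_c[of k] by (simp add: in_young_diagram)
      then have "X (A ! k) \<in> (poly_ring n :: 'k mpoly set)"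
        using M(1) by (intro X_in_poly_ring) auto
      then show "(-1) ^ k * (-1) ^ length B * X (A ! k) ^ (length A - 1 - length B) \<in> (poly_ring n :: 'k mpoly set)"
        by (intro mult_in_poly_ring power_in_poly_ring uminus_in_poly_ring one_in_poly_ring)
    qed
    finally show ?thesis .
  qed
qed

text \<open>Upward moves of single squares lead from any shape dominated by \<open>lam\<close> to \<open>lam\<close>. Each time the
  square is added to the first row \<open>i\<close> where \<open>rho\<close> and \<open>lam\<close> differ and taken from the row \<open>j\<close> after
  which the partial sums first agree again. Between these rows the partial sums of \<open>rho\<close> are strictly
  smaller, so the new shape is still dominated by \<open>lam\<close>, and the total defect of the partial sums
  decreases.\<close>

lemma specht_ideal_dominated:
  fixes lam rho :: "nat list"
  assumes "is_partition lam" "is_partition rho" "sum_list rho = sum_list lam"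
    and "\<And>k. (\<Sum>i<k. row rho i) \<le> (\<Sum>i<k. row lam i)"
    and "1 \<le> n" and "filling (mset [1..<n] + replicate_mset l n) rho T"
  shows "specht_poly rho T \<in> (specht_ideal n lam l :: 'k::field mpoly set)"
  using assms(2-4,6)
proof (induction "\<Sum>k\<le>sum_list lam. (\<Sum>i<k. row lam i) - (\<Sum>i<k. row rho i)" arbitrary: rho T rule: less_induct)
  case less
  note rho = less.prems(1,2) and dom = less.prems(3) and lam = assms(1)
  let ?s = "\<lambda>mu k. \<Sum>i<k. row mu i"
  show ?case
  proof (cases "\<forall>i. row rho i = row lam i")
    case True
    then have "rho = lam"
      using partition_eqI[OF rho(1) lam] by blast
    then show ?thesis
      using specht_poly_in_specht_ideal lam less.prems(4) by blast
  next
    case False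
    define i where "i = (LEAST i. row rho i \<noteq> row lam i)"
    have i: "row rho i \<noteq> row lam i"
    proof -
      obtain i0 where "row rho i0 \<noteq> row lam i0"
        using False by blast
      then show ?thesis
        unfolding i_def by (rule LeastI[of "\<lambda>i. row rho i \<noteq> row lam i"])
    qed
    have below_i: "row rho k = row lam k" if "k < i" for k
      using not_less_Least[OF that[unfolded i_def]] by blast
    have s_i: "?s rho i = ?s lam i"
      by (rule sum.cong) (auto simp: below_i)
    have row_i: "row rho i < row lam i"
      using dom[of "Suc i"] s_i i by simp
    have large: "?s rho k = ?s lam k" if "length rho \<le> k" "length lam \<le> k" for k
      using that by (simp add: sum_list_rows rho(2))
    define j where "j = (LEAST j. i \<le> j \<and> ?s rho (Suc j) = ?s lam (Suc j))"
    have "i \<le> max i (max (length rho) (length lam)) \<and>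
        ?s rho (Suc (max i (max (length rho) (length lam)))) = ?s lam (Suc (max i (max (length rho) (length lam))))"
      using large[of "Suc (max i (max (length rho) (length lam)))"] by (simp del: sum.lessThan_Suc)
    then have "i \<le> j \<and> ?s rho (Suc j) = ?s lam (Suc j)"
      unfolding j_def by (rule LeastI[of "\<lambda>j. i \<le> j \<and> ?s rho (Suc j) = ?s lam (Suc j)"])
    then have j: "i \<le> j" "?s rho (Suc j) = ?s lam (Suc j)"
      by blast+
    have strict: "?s rho (Suc k) < ?s lam (Suc k)" if "i \<le> k" "k < j" for k
    proof -
      have "?s rho (Suc k) \<noteq> ?s lam (Suc k)"
        using not_less_Least[of k "\<lambda>j. i \<le> j \<and> ?s rho (Suc j) = ?s lam (Suc j)"] that by (auto simp: j_def)
      then show ?thesis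
        using dom[of "Suc k"] by linarith
    qed
    have "i \<noteq> j"
      using j(2) s_i row_i by auto
    then have ij: "i < j"
      using j(1) by simp
    obtain j' where j': "j = Suc j'" "i \<le> j'"
      using ij by (cases j) auto
    have row_j: "row lam j < row rho j"
      using strict[of j'] j' j(2) by simp
    have row_Suc_j: "row rho (Suc j) \<le> row lam (Suc j)"
      using dom[of "Suc (Suc j)"] j(2) by simp
    define r where "r = (row rho)(i := row rho i + 1, j := row rho j - 1)"
    have "r (Suc k) \<le> r k" for k
    proof -
      have mono: "row rho (Suc k) \<le> row rho k" "row lam (Suc k) \<le> row lam k"
        using row_antimono rho(1) lam by auto
      consider "k = j" | "Suc k = i" | "k \<noteq> j" "Suc k \<noteq> i"
        by blast
      then show ?thesis
      proof cases
        case 1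
        then show ?thesis
          using mono ij row_j row_Suc_j by (simp add: r_def)
      next
        case 2
        then show ?thesis
          using mono ij row_i below_i[of k] by (auto simp: r_def)
      next
        case 3
        then show ?thesis
          using mono by (auto simp: r_def)
      qed
    qed
    then have "r b \<le> r a" if "a \<le> b" for a b
      using that by (rule lift_Suc_antimono_le)
    moreover have j_less: "j < length rho"
      using row_j row_pos_iff[OF rho(1), of j] by simp
    then have "r (length rho) = 0"
      using ij by (simp add: r_def row_eq_0)
    ultimately obtain rho' where rho': "is_partition rho'" "row rho' = r"
      using ex_partition_with_rows by metis
    have s_rho': "?s rho' k = (if i < k \<and> k \<le> j then Suc (?s rho k) else ?s rho k)" for k
    proof (induction k)
      case (Suc k)
      have "0 < row rho j"
        using row_j by simp
      then show ?case
        using Suc ij by (auto simp: rho'(2) r_def)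
    qed simp
    have sum_rho': "sum_list rho' = sum_list rho"
    proof -
      let ?k = "Suc (length rho + length rho')"
      have "sum_list rho' = ?s rho' ?k"
        by (rule sum_list_rows[symmetric]) simp
      also have "\<dots> = ?s rho ?k"
        using j_less by (simp add: s_rho' del: sum.lessThan_Suc)
      also have "\<dots> = sum_list rho"
        by (rule sum_list_rows) simp
      finally show ?thesis .
    qed
    have dom': "?s rho' k \<le> ?s lam k" for k
    proof (cases "i < k \<and> k \<le> j")
      case True
      then obtain k' where k': "k = Suc k'"
        by (cases k) auto
      then show ?thesis
        using strict[of k'] True s_rho'[of k] by (simp del: sum.lessThan_Suc)
    qed (use dom[of k] s_rho'[of k] in auto)
    have len_le: "length rho \<le> sum_list lam"
    proof -
      have "(\<Sum>i<length rho. 1) \<le> ?s rho (length rho)"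
        using row_pos_iff[OF rho(1)] by (intro sum_mono) (metis One_nat_def Suc_leI lessThan_iff)
      then show ?thesis
        using rho(2) by (simp add: sum_list_rows)
    qed
    have "(\<Sum>k\<le>sum_list lam. ?s lam k - ?s rho' k) < (\<Sum>k\<le>sum_list lam. ?s lam k - ?s rho k)"
    proof (rule sum_strict_mono_ex1)
      show "\<forall>k\<in>{..sum_list lam}. ?s lam k - ?s rho' k \<le> ?s lam k - ?s rho k"
        using s_rho' by auto
      have "?s lam (Suc i) - ?s rho' (Suc i) < ?s lam (Suc i) - ?s rho (Suc i)"
        using strict[of i] ij s_rho'[of "Suc i"] by (simp del: sum.lessThan_Suc)
      moreover have "Suc i \<le> sum_list lam"
        using len_le j_less ij by simp
      ultimately show "\<exists>k\<in>{..sum_list lam}. ?s lam k - ?s rho' k < ?s lam k - ?s rho k"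
        by blast
    qed simp
    then have IH: "specht_poly rho' T' \<in> (specht_ideal n lam l :: 'k mpoly set)"
      if "filling (mset [1..<n] + replicate_mset l n) rho' T'" for T'
      using less.hyps[OF _ rho'(1) _ dom' that] sum_rho' rho(2) by simp
    show ?thesis
    proof (rule move_box[OF rho(1) rho'(1) sum_rho'[symmetric] ij])
      show "row rho' = (row rho)(i := row rho i + 1, j := row rho j - 1)"
        by (simp add: rho'(2) r_def)
      show "0 < row rho j"
        using row_j by simp
      show "set_mset (mset [1..<n] + replicate_mset l n) \<subseteq> {1..n}"
        using assms(5) by auto
      show "filling (mset [1..<n] + replicate_mset l n) rho T"
        by (rule less.prems(4))
    qed (use IH in \<open>auto simp: specht_ideal_def\<close>)
  qed
qed

section \<open>Polynomials vanishing on points of prescribed types\<close>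

text \<open>The point \<open>(a 1, \<dots>, a N)\<close> takes the distinct values \<open>vs\<close> with the multiplicities \<open>mu\<close>, and \<open>vs\<close>
  is arranged such that \<open>mu\<close> is a partition.\<close>

definition point_type :: "nat \<Rightarrow> (nat \<Rightarrow> 'k) \<Rightarrow> 'k list \<Rightarrow> nat list \<Rightarrow> bool" where
  "point_type N a vs mu \<longleftrightarrow> distinct vs \<and> set vs = a ` {1..N} \<and> is_partition mu \<and>
     mu = map (\<lambda>v. card {j \<in> {1..N}. a j = v}) vs"

lemma point_type_partition: "point_type N a vs mu \<Longrightarrow> is_partition mu"
  unfolding point_type_def by blast

lemma card_fibre_Suc:
  "card {j \<in> {1..Suc N}. (a(Suc N := t)) j = v} = card {j \<in> {1..N}. a j = v} + (if v = t then 1 else 0)"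
proof -
  have "{j \<in> {1..Suc N}. (a(Suc N := t)) j = v} = {j \<in> {1..N}. a j = v} \<union> (if v = t then {Suc N} else {})"
    by auto
  then show ?thesis
    by (simp add: card_insert_if)
qed

lemma image_upd_Suc: "(a(Suc N := t)) ` {1..Suc N} = insert t (a ` {1..N})"
proof -
  have "(a(Suc N := t)) ` {1..N} = a ` {1..N}"
    by (rule image_cong) auto
  moreover have "{1..Suc N} = insert (Suc N) {1..N}"
    by auto
  ultimately show ?thesis
    by (simp only: image_insert fun_upd_same)
qed

lemma point_type_new_value:
  assumes "point_type N a vs mu" "t \<notin> set vs"
  shows "point_type (Suc N) (a(Suc N := t)) (vs @ [t]) (mu @ [1])"
proof -
  let ?f = "\<lambda>v. card {j \<in> {1..N}. a j = v}" and ?f' = "\<lambda>v. card {j \<in> {1..Suc N}. (a(Suc N := t)) j = v}"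
  have vs: "distinct vs" "set vs = a ` {1..N}" "mu = map ?f vs" "is_partition mu"
    using assms(1) unfolding point_type_def by blast+
  have "{j \<in> {1..N}. a j = t} = {}"
    using assms(2) vs(2) by blast
  then have "?f' t = 1"
    unfolding card_fibre_Suc by simp
  moreover have "map ?f' vs = map ?f vs"
  proof (rule map_cong)
    fix v assume "v \<in> set vs"
    then have "v \<noteq> t"
      using assms(2) by blast
    then show "?f' v = ?f v"
      unfolding card_fibre_Suc by simp
  qed simp
  ultimately have "mu @ [1] = map ?f' (vs @ [t])"
    using vs(3) by simp
  moreover have "is_partition (mu @ [1])"
    using vs(4) by (auto simp: is_partition_def sorted_wrt_append Suc_le_eq)
  moreover have "distinct (vs @ [t])"
    using vs(1) assms(2) by simp
  moreover have "set (vs @ [t]) = (a(Suc N := t)) ` {1..Suc N}"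
    unfolding image_upd_Suc vs(2)[symmetric] by simp
  ultimately show ?thesis
    unfolding point_type_def by blast
qed

text \<open>The box is added to the first row of the same length as row \<open>i\<close>, where it leaves a partition;
  this swaps two values of equal multiplicity.\<close>

lemma point_type_old_value:
  assumes "point_type N a vs mu" "i < length mu"
  shows "\<exists>i' vs'. i' \<le> i \<and> mu ! i' = mu ! i \<and>
    point_type (Suc N) (a(Suc N := vs ! i)) vs' (mu[i' := Suc (mu ! i')])"
proof -
  define i' where "i' = (LEAST k. mu ! k = mu ! i)"
  have i': "mu ! i' = mu ! i" "i' \<le> i"
    unfolding i'_def by (rule LeastI[of _ i]) (auto intro: Least_le)
  have before: "mu ! k \<noteq> mu ! i" if "k < i'" for k
    using not_less_Least[OF that[unfolded i'_def]] .
  define vs' where "vs' = vs[i := vs ! i', i' := vs ! i]"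
  let ?mu' = "mu[i' := Suc (mu ! i')]" and ?a' = "a(Suc N := vs ! i)"
  have vs: "distinct vs" "set vs = a ` {1..N}" "mu = map (\<lambda>v. card {j \<in> {1..N}. a j = v}) vs"
    and part: "is_partition mu"
    using assms(1) by (auto simp: point_type_def)
  have len: "length mu = length vs"
    using arg_cong[OF vs(3), of length] by simp
  have mu_nth: "card {j \<in> {1..N}. a j = vs ! k} = mu ! k" if "k < length vs" for k
    using arg_cong[OF vs(3), of "\<lambda>xs. xs ! k"] that by simp
  have "distinct vs'" "set vs' = set vs"
    unfolding vs'_def using vs(1) i' assms(2) len by auto
  moreover have "set vs = ?a' ` {1..Suc N}"
    unfolding image_upd_Suc using vs(2) nth_mem[of i vs] assms(2) len by auto
  moreover have "?mu' = map (\<lambda>v. card {j \<in> {1..Suc N}. ?a' j = v}) vs'"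
  proof (rule nth_equalityI)
    fix k assume "k < length ?mu'"
    then have k: "k < length vs"
      by (simp add: len)
    consider "k = i'" | "k = i" "k \<noteq> i'" | "k \<noteq> i" "k \<noteq> i'"
      by blast
    then show "?mu' ! k = map (\<lambda>v. card {j \<in> {1..Suc N}. ?a' j = v}) vs' ! k"
      unfolding card_fibre_Suc
      by cases (use i' assms(2) len k vs(1) mu_nth in \<open>auto simp: vs'_def nth_eq_iff_index_eq\<close>)
  qed (simp add: vs'_def len)
  moreover have "is_partition ?mu'"
    unfolding is_partition_def
  proof
    show "sorted_wrt (\<ge>) ?mu'"
      unfolding sorted_wrt_iff_nth_less
    proof (intro allI impI)
      fix x y assume xy: "x < y" "y < length ?mu'"
      then have "mu ! y \<le> mu ! x"
        using part by (simp add: is_partition_def sorted_wrt_iff_nth_less)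
      then show "?mu' ! y \<le> ?mu' ! x"
        using xy before[of x] i' by (cases "y = i'"; cases "x = i'") (auto simp: nth_list_update)
    qed
    show "\<forall>x\<in>set ?mu'. 0 < x"
      using part set_update_subset_insert[of mu i' "Suc (mu ! i')"] by (auto simp: is_partition_def)
  qed
  ultimately have "point_type (Suc N) ?a' vs' ?mu'"
    unfolding point_type_def by (intro conjI) (simp only:)+
  then show ?thesis
    using i' by blast
qed

text \<open>Up to a monomial factor, \<open>f\<close> is a polynomial in the variables \<open>1, \<dots>, N\<close>.\<close>

definition constant_outside :: "nat \<Rightarrow> 'k::field mpoly \<Rightarrow> bool" where
  "constant_outside N f \<longleftrightarrow> (\<forall>m\<in>Poly_Mapping.keys f. \<forall>m'\<in>Poly_Mapping.keys f. \<forall>j. j \<notin> {1..N} \<longrightarrow>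
     Poly_Mapping.lookup m j = Poly_Mapping.lookup m' j)"

text \<open>The largest variable decides first in the lexicographic order. Hence \<open>d\<close> is the degree of \<open>f\<close> in
  it, and the part of that degree has the same leading monomial.\<close>

lemma top_degree_part:
  assumes "f \<noteq> 0" "constant_outside (Suc N) f"
  defines "m \<equiv> initial_monomial lex_less f"
  defines "d \<equiv> Poly_Mapping.lookup m (Suc N)"
  shows "\<And>m'. m' \<in> Poly_Mapping.keys f \<Longrightarrow> Poly_Mapping.lookup m' (Suc N) \<le> d"
    and "leading (degree_part (Suc N) d f) m"
    and "constant_outside N (degree_part (Suc N) d f)"
proof -
  have m: "leading f m"
    using leading_initial_monomial[OF assms(1)] by (simp add: m_def)
  show "Poly_Mapping.lookup m' (Suc N) \<le> d" if "m' \<in> Poly_Mapping.keys f" for m'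
  proof (cases "m' = m")
    case False
    then have "lex_less m' m"
      using m that by (simp add: leading_def)
    then obtain i where i: "Poly_Mapping.lookup m' i < Poly_Mapping.lookup m i"
        "\<And>j. j > i \<Longrightarrow> Poly_Mapping.lookup m' j = Poly_Mapping.lookup m j"
      unfolding lex_less_def by blast
    have "i \<in> {1..Suc N}"
    proof (rule ccontr)
      assume "i \<notin> {1..Suc N}"
      then have "Poly_Mapping.lookup m' i = Poly_Mapping.lookup m i"
        using assms(2) that m unfolding constant_outside_def leading_def by blast
      then show False
        using i(1) by simp
    qed
    then show ?thesis
      using i by (cases "i = Suc N") (auto simp: d_def)
  qed (simp add: d_def)
  show "leading (degree_part (Suc N) d f) m"
    using m by (auto simp: leading_def keys_degree_part d_def)
  show "constant_outside N (degree_part (Suc N) d f)"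
    unfolding constant_outside_def keys_degree_part
  proof (intro ballI allI impI)
    fix m1 m2 j
    assume "m1 \<in> {m \<in> Poly_Mapping.keys f. Poly_Mapping.lookup m (Suc N) = d}"
      "m2 \<in> {m \<in> Poly_Mapping.keys f. Poly_Mapping.lookup m (Suc N) = d}" "j \<notin> {1..N}"
    note m12 = this
    show "Poly_Mapping.lookup m1 j = Poly_Mapping.lookup m2 j"
    proof (cases "j = Suc N")
      case False
      then have "j \<notin> {1..Suc N}"
        using m12(3) by auto
      then show ?thesis
        using assms(2) m12(1,2) unfolding constant_outside_def by blast
    qed (use m12 in simp)
  qed
qed

lemma lookup_specht_monomial_eq_0:
  assumes "standard_filling M mu T" "k \<notin># M"
  shows "Poly_Mapping.lookup (specht_monomial mu T) k = 0"
proof -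
  have "T x \<noteq> k" if "x \<in> young_diagram mu" for x
    using assms that by (auto simp: standard_filling_def)
  then show ?thesis
    by (simp add: specht_monomial_def lookup_sum lookup_single)
qed

text \<open>The step common to both eliminations of a variable: a divisor of a monomial that comes from a
  standard filling without the entry \<open>Suc N\<close> is enlarged by a horizontal strip, as far as the exponent
  of \<open>x\<^bsub>Suc N\<^esub>\<close> permits.\<close>

lemma standard_filling_extend_divides:
  assumes "is_partition mu" "is_partition rho" "horizontal_strip mu rho"
    and "standard_filling (mset [1..<Suc N]) mu T"
    and sum: "sum_list rho = sum_list mu + l"
    and div: "\<And>i. Poly_Mapping.lookup (specht_monomial mu T) i \<le> Poly_Mapping.lookup m i"
    and weight: "(\<Sum>i<length rho. i * (row rho i - row mu i)) \<le> Poly_Mapping.lookup m (Suc N)"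
  obtains T' where "standard_filling (mset [1..<Suc N] + replicate_mset l (Suc N)) rho T'"
    "\<And>i. Poly_Mapping.lookup (specht_monomial rho T') i \<le> Poly_Mapping.lookup m i"
proof -
  obtain T' where T': "standard_filling (mset [1..<Suc N] + replicate_mset (sum_list rho - sum_list mu) (Suc N)) rho T'"
      "specht_monomial rho T' = specht_monomial mu T +
        Poly_Mapping.single (Suc N) (\<Sum>i<length rho. i * (row rho i - row mu i))"
    using standard_filling_extend[OF assms(1,2,4,3), of "Suc N"] by (auto simp del: upt_Suc)
  show ?thesis
  proof
    show "standard_filling (mset [1..<Suc N] + replicate_mset l (Suc N)) rho T'"
      using T'(1) sum by (simp del: upt_Suc)
    fix i
    show "Poly_Mapping.lookup (specht_monomial rho T') i \<le> Poly_Mapping.lookup m i"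
    proof (cases "i = Suc N")
      case True
      have "Poly_Mapping.lookup (specht_monomial mu T) (Suc N) = 0"
        by (rule lookup_specht_monomial_eq_0[OF assms(4)]) simp
      then show ?thesis
        using True weight by (simp add: T'(2) lookup_add)
    next
      case False
      then show ?thesis
        using div[of i] by (simp add: T'(2) lookup_add lookup_single)
    qed
  qed
qed

text \<open>Let \<open>g\<close> be the coefficient of the top power \<open>d\<close> of the last variable. If \<open>g\<close> does not vanish at a
  point of type \<open>mu\<close>, then \<open>f\<close> restricts to a polynomial of degree \<open>d\<close> on the line over this point,
  with at most \<open>d\<close> zeros. So \<open>f\<close> is nonzero at one of the first \<open>d + 1\<close> values of the point, or, if
  there are not that many, at a new value, which exists because the field is infinite. In both cases
  adding a box to \<open>mu\<close> in a row of index at most \<open>d\<close> leads to a shape in \<open>F\<close>. By induction some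
  standard filling of such a shape \<open>mu\<close> divides the initial monomial of \<open>g\<close>, and the new entry in the
  added box contributes no more than the exponent \<open>d\<close>.\<close>

theorem initial_monomial_of_vanishing_poly:
  fixes f :: "'k::field mpoly"
  assumes "infinite (UNIV :: 'k set)" "f \<noteq> 0" "constant_outside N f"
    and "\<And>a vs mu. (\<And>j. j \<notin> {1..N} \<Longrightarrow> a j = 1) \<Longrightarrow> point_type N a vs mu \<Longrightarrow> mpeval a f \<noteq> 0 \<Longrightarrow> mu \<in> F"
  shows "\<exists>mu\<in>F. \<exists>T. is_partition mu \<and> sum_list mu = N \<and> standard_filling (mset [1..<Suc N]) mu T \<and>
    (\<forall>i. Poly_Mapping.lookup (specht_monomial mu T) i \<le> Poly_Mapping.lookup (initial_monomial lex_less f) i)"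
  using assms(2-4)
proof (induction N arbitrary: f F)
  case 0
  let ?m = "initial_monomial lex_less f"
  have m: "?m \<in> Poly_Mapping.keys f"
    using leading_initial_monomial[OF 0(1)] by (simp add: leading_def)
  have "m' = ?m" if "m' \<in> Poly_Mapping.keys f" for m'
  proof (rule poly_mapping_eqI)
    fix j
    have "j \<notin> {1..0::nat}"
      by simp
    then show "Poly_Mapping.lookup m' j = Poly_Mapping.lookup ?m j"
      using 0(2) m that unfolding constant_outside_def by blast
  qed
  then have "Poly_Mapping.keys f = {?m}"
    using m by blast
  moreover have "Poly_Mapping.lookup f ?m \<noteq> 0"
    using m by (simp add: in_keys_iff)
  ultimately have "mpeval (\<lambda>_. 1) f \<noteq> 0"
    by (simp add: insertion_def)
  moreover have "point_type 0 (\<lambda>_. 1 :: 'k) [] []"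
    by (simp add: point_type_def is_partition_def)
  ultimately have "[] \<in> F"
    using 0(3)[of "\<lambda>_. 1"] by simp
  moreover have "young_diagram [] = {}"
    by (simp add: young_diagram_def)
  then have "standard_filling (mset [1..<Suc 0]) [] (\<lambda>_. undefined)" "specht_monomial [] (\<lambda>_. undefined) = 0"
    by (simp_all add: standard_filling_def specht_monomial_def)
  ultimately show ?case
    by (intro bexI[of _ "[]"] exI[of _ "\<lambda>_. undefined"]) (auto simp: is_partition_def)
next
  case (Suc N)
  let ?m = "initial_monomial lex_less f"
  define d where "d = Poly_Mapping.lookup ?m (Suc N)"
  define g where "g = degree_part (Suc N) d f"
  note top = top_degree_part[OF Suc.prems(1,2), folded d_def, folded g_def]
  define F' where "F' = {mu. is_partition mu \<and> (\<exists>rho\<in>F. is_partition rho \<and>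
     (\<exists>i\<le>d. row rho = (row mu)(i := Suc (row mu i))))}"
  have "mu \<in> F'" if a: "\<And>j. j \<notin> {1..N} \<Longrightarrow> a j = 1" and type: "point_type N a vs mu"
    and nz: "mpeval a g \<noteq> 0" for a vs mu
  proof -
    define Q where "Q = fibre_poly a (Suc N) f"
    have "a (Suc N) = 1"
      using a by simp
    then have Q: "degree Q \<le> d" "Q \<noteq> 0"
      using degree_fibre_poly_le[of a "Suc N" f d] top(1) coeff_fibre_poly[of a "Suc N" f d] nz
      by (auto simp: Q_def g_def)
    have in_F: "rho \<in> F" if "point_type (Suc N) (a(Suc N := t)) vs' rho" "poly Q t \<noteq> 0" for t vs' rho
    proof (rule Suc.prems(3)[OF _ that(1)])
      show "mpeval (a(Suc N := t)) f \<noteq> 0"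
        using that(2) by (simp only: Q_def poly_fibre_poly not_False_eq_True)
      show "(a(Suc N := t)) j = 1" if "j \<notin> {1..Suc N}" for j
        using that a[of j] by auto
    qed
    have mu: "is_partition mu" "length mu = length vs" "distinct vs"
      using type by (auto simp: point_type_def)
    have roots: "finite {x. poly Q x = 0}" "card {x. poly Q x = 0} \<le> d"
      using poly_roots_finite[OF Q(2)] card_poly_roots_bound[OF Q(2)] Q(1) by auto
    show ?thesis
    proof (cases "d < length mu")
      case True
      have "\<exists>i\<le>d. poly Q (vs ! i) \<noteq> 0"
      proof (rule ccontr)
        assume "\<not> ?thesis"
        then have "(\<lambda>i. vs ! i) ` {..d} \<subseteq> {x. poly Q x = 0}"
          by auto
        then have "card ((\<lambda>i. vs ! i) ` {..d}) \<le> d"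
          using card_mono[OF roots(1)] roots(2) le_trans by blast
        moreover have "inj_on (\<lambda>i. vs ! i) {..d}"
          using mu True by (auto simp: inj_on_def nth_eq_iff_index_eq)
        ultimately show False
          by (simp add: card_image)
      qed
      then obtain i where i: "i \<le> d" "poly Q (vs ! i) \<noteq> 0"
        by blast
      then obtain i' vs' where i': "i' \<le> i" "mu ! i' = mu ! i"
          "point_type (Suc N) (a(Suc N := vs ! i)) vs' (mu[i' := Suc (mu ! i')])"
        using point_type_old_value[OF type, of i] True by auto
      have "i' < length mu"
        using i' i True by simp
      then have "row (mu[i' := Suc (mu ! i')]) = (row mu)(i' := Suc (row mu i'))"
        by (auto simp: row_def)
      then show ?thesis
        using in_F[OF i'(3) i(2)] point_type_partition[OF i'(3)] le_trans[OF i'(1) i(1)] mu(1)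
        unfolding F'_def by blast
    next
      case False
      have "finite ({x. poly Q x = 0} \<union> set vs)"
        using roots by simp
      then obtain t where t: "poly Q t \<noteq> 0" "t \<notin> set vs"
        using ex_new_if_finite[OF assms(1)] by blast
      then have "mu @ [1] \<in> F" "is_partition (mu @ [1])"
        using in_F[OF point_type_new_value[OF type t(2)] t(1)]
          point_type_partition[OF point_type_new_value[OF type t(2)]] by blast+
      moreover have "row (mu @ [1]) = (row mu)(length mu := Suc (row mu (length mu)))"
        by (auto simp: row_def nth_append)
      moreover have "length mu \<le> d"
        using False by simp
      ultimately show ?thesis
        using mu(1) unfolding F'_def by blast
    qed
  qed
  then obtain mu T where muT: "mu \<in> F'" "is_partition mu" "sum_list mu = N"
      "standard_filling (mset [1..<Suc N]) mu T"
      "\<And>i. Poly_Mapping.lookup (specht_monomial mu T) i \<le> Poly_Mapping.lookup (initial_monomial lex_less g) i"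
    using Suc.IH[of g F'] top(2,3) leading_nonzero by blast
  then obtain rho i where rho: "rho \<in> F" "is_partition rho" "i \<le> d" "row rho = (row mu)(i := Suc (row mu i))"
    unfolding F'_def by blast
  have init: "initial_monomial lex_less g = ?m"
    using top(2) by (rule initial_monomial_eq)
  have i_less: "i < length rho"
    using row_pos_iff[OF rho(2), of i] by (simp add: rho(4))
  have sum: "sum_list rho = Suc N"
  proof -
    let ?k = "Suc (i + length mu + length rho)"
    have "sum_list rho = (\<Sum>k<?k. row rho k)"
      by (rule sum_list_rows[symmetric]) simp
    also have "\<dots> = (\<Sum>k<?k. row mu k + (if k = i then 1 else 0))"
      by (rule sum.cong) (auto simp: rho(4))
    also have "\<dots> = (\<Sum>k<?k. row mu k) + 1"
      unfolding sum.distrib by (subst sum.delta) auto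
    also have "(\<Sum>k<?k. row mu k) = N"
      using muT(3) by (subst sum_list_rows) auto
    finally show ?thesis
      by simp
  qed
  have weight: "(\<Sum>k<length rho. k * (row rho k - row mu k)) = i"
  proof -
    have "(\<Sum>k<length rho. k * (row rho k - row mu k)) = (\<Sum>k<length rho. if k = i then i else 0)"
      by (rule sum.cong) (auto simp: rho(4))
    then show ?thesis
      using i_less by simp
  qed
  have "horizontal_strip mu rho"
    unfolding horizontal_strip_def
  proof (intro allI conjI)
    fix k
    show "row rho (Suc k) \<le> row mu k"
    proof (cases "Suc k = i")
      case True
      then show ?thesis
        using row_antimono[OF rho(2), of k "Suc k"] by (auto simp: rho(4))
    qed (use row_antimono[OF muT(2), of k "Suc k"] in \<open>simp add: rho(4)\<close>)
  qed (simp add: rho(4))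
  then obtain T' where T': "standard_filling (mset [1..<Suc N] + replicate_mset 1 (Suc N)) rho T'"
      "\<And>i. Poly_Mapping.lookup (specht_monomial rho T') i \<le> Poly_Mapping.lookup ?m i"
    using standard_filling_extend_divides[OF muT(2) rho(2) _ muT(4) _ muT(5)[unfolded init], of 1]
      sum muT(3) rho(3) unfolding weight d_def by auto
  have "mset [1..<Suc N] + replicate_mset 1 (Suc N) = mset [1..<Suc (Suc N)]"
    by simp
  then show ?case
    using rho(1,2) sum T' by metis
qed

section \<open>Overlaps and horizontal strips\<close>

text \<open>Suppose that a diagram of shape \<open>lam\<close> is filled with values of multiplicities \<open>mu\<close> and with \<open>l\<close>
  copies of a variable, without repetition in any column. How many columns must contain the variable
  together with the value number \<open>i\<close>? For a set \<open>S\<close> of values containing it, a column without this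
  overlap has at most \<open>card S\<close> squares in which a value from \<open>S\<close> or the variable stands, and all
  columns together have \<open>\<Sum>k<card S. row lam k\<close> squares in the first \<open>card S\<close> rows. The excess over
  this number must be made up by overlaps; this is the best bound over all \<open>S\<close>. Truncated subtraction
  makes it 0 if there is no excess.\<close>

definition required_overlap :: "nat list \<Rightarrow> nat list \<Rightarrow> nat \<Rightarrow> nat \<Rightarrow> nat" where
  "required_overlap lam mu l i = Max ((\<lambda>S. (\<Sum>s\<in>S. row mu s) + l - (\<Sum>k<card S. row lam k)) `
     {S. S \<subseteq> {..<length mu} \<and> i \<in> S})"

lemma finite_index_sets: "finite {S. S \<subseteq> {..<p::nat} \<and> i \<in> S}"
  by (rule finite_subset[of _ "Pow {..<p}"]) auto

lemma required_overlap_ge: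
  assumes "S \<subseteq> {..<length mu}" "i \<in> S"
  shows "(\<Sum>s\<in>S. row mu s) + l \<le> (\<Sum>k<card S. row lam k) + required_overlap lam mu l i"
proof -
  have "(\<Sum>s\<in>S. row mu s) + l - (\<Sum>k<card S. row lam k) \<le> required_overlap lam mu l i"
    unfolding required_overlap_def using assms by (intro Max_ge finite_imageI finite_index_sets) auto
  then show ?thesis
    by linarith
qed

lemma required_overlap_le:
  assumes "i < length mu"
    and "\<And>S. S \<subseteq> {..<length mu} \<Longrightarrow> i \<in> S \<Longrightarrow> (\<Sum>s\<in>S. row mu s) + l \<le> (\<Sum>k<card S. row lam k) + e"
  shows "required_overlap lam mu l i \<le> e"
  unfolding required_overlap_def
proof (subst Max_le_iff)
  have "{i} \<in> {S. S \<subseteq> {..<length mu} \<and> i \<in> S}"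
    using assms(1) by simp
  then show "(\<lambda>S. (\<Sum>s\<in>S. row mu s) + l - (\<Sum>k<card S. row lam k)) ` {S. S \<subseteq> {..<length mu} \<and> i \<in> S} \<noteq> {}"
    by blast
qed (use assms(2) in \<open>auto intro: finite_index_sets simp: le_diff_conv add.commute\<close>)

text \<open>Exchanging the indices \<open>i\<close> and \<open>i + 1\<close> in a set \<open>S\<close> changes the excess by the difference of the two
  rows.\<close>

lemma required_overlap_Suc:
  assumes "is_partition mu" "Suc i < length mu"
  shows "required_overlap lam mu l (Suc i) \<le> required_overlap lam mu l i"
    and "required_overlap lam mu l i + row mu (Suc i) \<le> required_overlap lam mu l (Suc i) + row mu i"
proof -
  have mono: "row mu (Suc i) \<le> row mu i"
    using row_antimono[OF assms(1)] by simp
  have fin: "finite S" if "S \<subseteq> {..<length mu}" for S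
    using that finite_subset by blast
  have swap: "\<exists>S'. S' \<subseteq> {..<length mu} \<and> b \<in> S' \<and> card S' = card S \<and>
      (\<Sum>s\<in>S'. row mu s) + row mu a = (\<Sum>s\<in>S. row mu s) + row mu b"
    if S: "S \<subseteq> {..<length mu}" "a \<in> S" "b \<notin> S" and b: "b < length mu" for S a b
  proof (intro exI conjI)
    let ?S' = "insert b (S - {a})"
    show "?S' \<subseteq> {..<length mu}" "b \<in> ?S'"
      using S b by auto
    have "card ?S' = Suc (card (S - {a}))"
      using S fin[OF S(1)] by (intro card_insert_disjoint) auto
    also have "\<dots> = card S"
      using S(2) fin[OF S(1)] by (intro card_Suc_Diff1)
    finally show "card ?S' = card S" .
    have "(\<Sum>s\<in>?S'. row mu s) = row mu b + (\<Sum>s\<in>S - {a}. row mu s)"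
      using S fin[OF S(1)] by (intro sum.insert) auto
    moreover have "(\<Sum>s\<in>S. row mu s) = row mu a + (\<Sum>s\<in>S - {a}. row mu s)"
      using S fin[OF S(1)] by (intro sum.remove) auto
    ultimately show "(\<Sum>s\<in>?S'. row mu s) + row mu a = (\<Sum>s\<in>S. row mu s) + row mu b"
      by simp
  qed
  show "required_overlap lam mu l (Suc i) \<le> required_overlap lam mu l i"
  proof (rule required_overlap_le[OF assms(2)])
    fix S assume S: "S \<subseteq> {..<length mu}" "Suc i \<in> S"
    show "(\<Sum>s\<in>S. row mu s) + l \<le> (\<Sum>k<card S. row lam k) + required_overlap lam mu l i"
    proof (cases "i \<in> S")
      case False
      then obtain S' where "S' \<subseteq> {..<length mu}" "i \<in> S'" "card S' = card S"
          "(\<Sum>s\<in>S'. row mu s) + row mu (Suc i) = (\<Sum>s\<in>S. row mu s) + row mu i"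
        using swap[OF S, of i] assms(2) by auto
      then show ?thesis
        using required_overlap_ge[of S' mu i l lam] mono by simp
    qed (use required_overlap_ge S in blast)
  qed
  have "required_overlap lam mu l i \<le> required_overlap lam mu l (Suc i) + (row mu i - row mu (Suc i))"
  proof (rule required_overlap_le)
    show "i < length mu"
      using assms(2) by simp
    fix S assume S: "S \<subseteq> {..<length mu}" "i \<in> S"
    show "(\<Sum>s\<in>S. row mu s) + l \<le>
        (\<Sum>k<card S. row lam k) + (required_overlap lam mu l (Suc i) + (row mu i - row mu (Suc i)))"
    proof (cases "Suc i \<in> S")
      case True
      then show ?thesis
        using required_overlap_ge[OF S(1), of "Suc i" l lam] by simp
    next
      case False
      then obtain S' where "S' \<subseteq> {..<length mu}" "Suc i \<in> S'" "card S' = card S"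
          "(\<Sum>s\<in>S'. row mu s) + row mu i = (\<Sum>s\<in>S. row mu s) + row mu (Suc i)"
        using swap[OF S, of "Suc i"] assms(2) by auto
      then show ?thesis
        using required_overlap_ge[of S' mu "Suc i" l lam] mono by simp
    qed
  qed
  then show "required_overlap lam mu l i + row mu (Suc i) \<le> required_overlap lam mu l (Suc i) + row mu i"
    using mono by linarith
qed

text \<open>Let \<open>M 0 = l\<close> and let \<open>M (i + 1)\<close> be the overlap required for the value number \<open>i\<close>. Adding
  \<open>M j - M (j + 1)\<close> squares to row \<open>j\<close> distributes \<open>l\<close> squares in total. The sum of the first \<open>k\<close> rows
  grows by \<open>l - M k\<close>, which the choice \<open>S = {..<k}\<close> in the definition of the required overlap keeps
  it below that of \<open>lam\<close>; the squares interlace because \<open>M\<close> decreases no faster than the rows of \<open>mu\<close>;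
  and summation by parts turns the weighted sum over the strip into \<open>\<Sum>j. M (j + 1)\<close>.\<close>

lemma ex_horizontal_strip:
  assumes mu: "is_partition mu" and lam: "is_partition lam" "sum_list lam = sum_list mu + l" "length lam \<le> Suc (length mu)"
    and bound: "\<And>i. i < length mu \<Longrightarrow> required_overlap lam mu l i \<le> l"
      "\<And>i. i < length mu \<Longrightarrow> required_overlap lam mu l i \<le> row mu i"
  obtains rho where "is_partition rho" "horizontal_strip mu rho" "sum_list rho = sum_list mu + l" "l \<le> row rho 0"
    "\<And>k. (\<Sum>i<k. row rho i) \<le> (\<Sum>i<k. row lam i)"
    "(\<Sum>i<length rho. i * (row rho i - row mu i)) = (\<Sum>i<length mu. required_overlap lam mu l i)"
proof -
  let ?m = "required_overlap lam mu l" and ?p = "length mu"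
  define M where "M j = (case j of 0 \<Rightarrow> l | Suc i \<Rightarrow> if i < ?p then ?m i else 0)" for j
  have M_simps [simp]: "M 0 = l" "M (Suc i) = (if i < ?p then ?m i else 0)" for i
    by (simp_all add: M_def)
  have M_mono: "M (Suc j) \<le> M j" for j
    using required_overlap_Suc(1)[OF mu] bound(1) by (cases j) auto
  define r where "r j = row mu j + M j - M (Suc j)" for j
  have r_strip: "r (Suc j) \<le> row mu j" for j
  proof -
    consider "Suc j < ?p" | "Suc j = ?p" | "?p < Suc j"
      by linarith
    then show ?thesis
    proof cases
      case 1
      then show ?thesis
        using required_overlap_Suc(2)[OF mu 1, of lam l] by (simp add: r_def)
    next
      case 2
      then show ?thesis
        using bound(2)[of j] unfolding r_def M_simps by (simp add: row_eq_0)
    qed (simp add: r_def row_eq_0)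
  qed
  have r_ge: "row mu j \<le> r j" for j
    using M_mono[of j] unfolding r_def by linarith
  have "r (Suc j) \<le> r j" for j
    using r_strip r_ge le_trans by blast
  then have "r b \<le> r a" if "a \<le> b" for a b
    using that by (rule lift_Suc_antimono_le)
  moreover have "r (Suc ?p) = 0"
    by (simp add: r_def row_eq_0)
  ultimately obtain rho where rho: "is_partition rho" "row rho = r"
    using ex_partition_with_rows by metis
  have len: "length rho \<le> Suc ?p"
    using row_pos_iff[OF rho(1), of "Suc ?p"] \<open>r (Suc ?p) = 0\<close> by (simp add: rho(2))
  have sums: "(\<Sum>i<k. r i) + M k = (\<Sum>i<k. row mu i) + l" for k
  proof (induction k)
    case (Suc k)
    then show ?case
      using M_mono[of k] by (simp add: r_def del: M_simps)
  qed simp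
  have sum_rho: "sum_list rho = sum_list mu + l"
    using sums[of "Suc ?p"] sum_list_rows[OF len] sum_list_rows[of mu "Suc ?p"] by (simp add: rho(2))
  have dom: "(\<Sum>i<k. row rho i) \<le> (\<Sum>i<k. row lam i)" for k
  proof -
    consider "k = 0" | "0 < k" "k \<le> ?p" | "Suc ?p \<le> k"
      by linarith
    then show ?thesis
    proof cases
      case 2
      then obtain k' where k': "k = Suc k'"
        by (cases k) auto
      then have "{..<k} \<subseteq> {..<?p}" "k' \<in> {..<k}"
        using 2 by auto
      from required_overlap_ge[OF this, of l lam] sums[of k] 2 k' show ?thesis
        by (simp add: rho(2))
    next
      case 3
      then have "(\<Sum>i<k. row lam i) = sum_list mu + l"
        using lam by (simp add: sum_list_rows)
      then show ?thesis
        using sum_rows_le[of rho k] sum_rho by simp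
    qed simp
  qed
  have weight: "(\<Sum>j<k. j * (M j - M (Suc j))) + k * M k = (\<Sum>j<k. M (Suc j))" for k
  proof (induction k)
    case (Suc k)
    have "k * (M k - M (Suc k)) + k * M (Suc k) = k * M k"
      using M_mono[of k] by (metis add_mult_distrib2 le_add_diff_inverse2)
    then show ?case
      using Suc by (simp del: M_simps)
  qed simp
  have "(\<Sum>i<length rho. i * (row rho i - row mu i)) = (\<Sum>i<Suc ?p. i * (row rho i - row mu i))"
    using len by (intro sum.mono_neutral_left) (auto simp: row_eq_0)
  also have "\<dots> = (\<Sum>i<Suc ?p. i * (M i - M (Suc i)))"
    using M_mono by (intro sum.cong) (auto simp: rho(2) r_def simp del: M_simps)
  also have "\<dots> = (\<Sum>j<Suc ?p. M (Suc j))"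
    using weight[of "Suc ?p"] by simp
  also have "\<dots> = (\<Sum>i<?p. ?m i)"
    by simp
  finally have "(\<Sum>i<length rho. i * (row rho i - row mu i)) = (\<Sum>i<?p. ?m i)" .
  moreover have "l \<le> row rho 0"
  proof (cases "?p = 0")
    case False
    then show ?thesis
      using bound(2)[of 0] bound(1)[of 0] by (simp add: rho(2) r_def)
  qed (simp add: rho(2) r_def)
  moreover have "horizontal_strip mu rho"
    using r_strip r_ge by (simp add: horizontal_strip_def rho(2))
  ultimately show ?thesis
    using that rho(1) sum_rho dom by blast
qed

section \<open>Specht polynomials on a line\<close>

lemma size_filter_content:
  "size (filter_mset P (mset [1..<n] + replicate_mset l n)) =
    card {j \<in> {1..<n}. P j} + (if P n then l else 0)"
proof -
  have "size (filter_mset P (mset [1..<n])) = card {j \<in> {1..<n}. P j}"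
    by (simp add: filter_mset_mset_set)
  moreover have "filter_mset P (replicate_mset l n) = (if P n then replicate_mset l n else {#})"
    by (induction l) auto
  ultimately show ?thesis
    by (simp del: mset_upt)
qed

lemma card_filling_cells:
  assumes "filling M mu T"
  shows "card {x \<in> young_diagram mu. P (T x)} = size (filter_mset P M)"
proof -
  have "M = image_mset T (mset_set (young_diagram mu))"
    using assms by (simp add: filling_def)
  then have "filter_mset P M = image_mset T (filter_mset (\<lambda>x. P (T x)) (mset_set (young_diagram mu)))"
    by (simp add: filter_mset_image_mset)
  then show ?thesis
    by (simp add: filter_mset_mset_set)
qed

lemma Tab_filling: "T \<in> Tab n lam l \<Longrightarrow> filling (mset [1..<n] + replicate_mset l n) lam T"
  by (simp add: Tab_def filling_def)

text \<open>A filling whose Specht polynomial does not vanish identically on the line over the point \<open>a\<close> in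
  the direction of the last variable.\<close>

locale filling_on_line =
  fixes a :: "nat \<Rightarrow> 'k::field" and N l :: nat and vs :: "'k list" and mu lam :: "nat list"
    and T :: "nat \<times> nat \<Rightarrow> nat"
  assumes type: "point_type N a vs mu"
    and lam: "is_partition lam"
    and T: "filling (mset [1..<Suc N] + replicate_mset l (Suc N)) lam T"
    and nonzero: "fibre_poly a (Suc N) (specht_poly lam T) \<noteq> 0"
begin

abbreviation "var \<equiv> [:0, 1:] :: 'k poly"
abbreviation "val s \<equiv> [:vs ! s:]"

text \<open>What the Specht polynomial sees of the entry of a square after restriction to the line.\<close>

definition label :: "nat \<times> nat \<Rightarrow> 'k poly" where
  "label x = line a (Suc N) (T x)"

definition labels :: "nat \<Rightarrow> 'k poly set" where
  "labels c = (\<lambda>r. label (r, c)) ` {..<height lam c}"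

definition overlap :: "nat \<Rightarrow> nat set" where
  "overlap i = {c \<in> {..<row lam 0}. val i \<in> labels c \<and> var \<in> labels c}"

lemma fibre_poly_eq:
  "fibre_poly a (Suc N) (specht_poly lam T) =
    (\<Prod>c<row lam 0. \<Prod>(r, r')\<in>{(r, r'). r < r' \<and> r' < height lam c}. label (r, c) - label (r', c))"
proof -
  have "(\<Prod>(r, r')\<in>{(r, r'). r < r' \<and> r' < height lam c}.
        line a (Suc N) (column lam T c ! r) - line a (Suc N) (column lam T c ! r'))
      = (\<Prod>(r, r')\<in>{(r, r'). r < r' \<and> r' < height lam c}. label (r, c) - label (r', c))" for c
    by (rule prod.cong) (auto simp: column_eq[OF lam] label_def)
  then show ?thesis
    unfolding specht_poly_eq[OF lam order_refl] const_hom.insertion_prod const_hom.insertion_difference_product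
    by (simp add: column_eq[OF lam])
qed

lemma finite_pairs: "finite {(r, r'). r < r' \<and> r' < (h::nat)}"
  by (rule finite_subset[of _ "{..<h} \<times> {..<h}"]) auto

lemma inj_label: "c < row lam 0 \<Longrightarrow> inj_on (\<lambda>r. label (r, c)) {..<height lam c}"
proof (rule linorder_inj_onI')
  fix r r' assume c: "c < row lam 0" and r: "r \<in> {..<height lam c}" "r' \<in> {..<height lam c}" "r < r'"
  have "(\<Prod>(r, r')\<in>{(r, r'). r < r' \<and> r' < height lam c}. label (r, c) - label (r', c)) \<noteq> 0"
    using nonzero c unfolding fibre_poly_eq by (simp add: prod_zero_iff)
  moreover have "(r, r') \<in> {(r, r'). r < r' \<and> r' < height lam c}"
    using r by simp
  ultimately have "label (r, c) - label (r', c) \<noteq> 0"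
    using finite_pairs by (force simp: prod_zero_iff)
  then show "label (r, c) \<noteq> label (r', c)"
    by simp
qed

lemma card_labels: "c < row lam 0 \<Longrightarrow> card (labels c) = height lam c"
  unfolding labels_def using inj_label by (simp add: card_image)

lemma val_neq_var: "[:v:] \<noteq> var"
  by simp

lemma mu_nth: "s < length mu \<Longrightarrow> row mu s = card {j \<in> {1..N}. a j = vs ! s}"
proof -
  assume s: "s < length mu"
  have mu: "mu = map (\<lambda>v. card {j \<in> {1..N}. a j = v}) vs"
    using type unfolding point_type_def by blast
  show ?thesis
    using arg_cong[OF mu, of "\<lambda>xs. xs ! s"] s arg_cong[OF mu, of length] by (simp add: row_def)
qed

lemma length_vs: "length vs = length mu" and distinct_vs: "distinct vs" and set_vs: "set vs = a ` {1..N}"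
  and mu: "is_partition mu"
proof -
  have "mu = map (\<lambda>v. card {j \<in> {1..N}. a j = v}) vs"
    using type unfolding point_type_def by blast
  from arg_cong[OF this, of length] show "length vs = length mu"
    by simp
qed (use type in \<open>unfold point_type_def, blast+\<close>)

lemma card_var_cells: "card {x \<in> young_diagram lam. label x = var} = l"
proof -
  have "{j \<in> {1..<Suc N}. line a (Suc N) j = var} = {}"
    by (auto simp: line_def)
  then have "size (filter_mset (\<lambda>k. line a (Suc N) k = var) (mset [1..<Suc N] + replicate_mset l (Suc N))) = l"
    unfolding size_filter_content by (simp add: line_def)
  then show ?thesis
    unfolding label_def card_filling_cells[OF T, of "\<lambda>k. line a (Suc N) k = var"] .
qed

lemma card_val_cells:
  assumes "s < length mu"
  shows "card {x \<in> young_diagram lam. label x = val s} = row mu s"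
proof -
  have "{j \<in> {1..<Suc N}. line a (Suc N) j = val s} = {j \<in> {1..N}. a j = vs ! s}"
    by (auto simp: line_def)
  then have "size (filter_mset (\<lambda>k. line a (Suc N) k = val s) (mset [1..<Suc N] + replicate_mset l (Suc N))) = row mu s"
    unfolding size_filter_content mu_nth[OF assms] by (simp add: line_def)
  then show ?thesis
    unfolding label_def card_filling_cells[OF T, of "\<lambda>k. line a (Suc N) k = val s"] .
qed

lemma label_cases:
  assumes "x \<in> young_diagram lam"
  shows "label x \<in> insert var (val ` {..<length mu})"
proof (cases "T x = Suc N")
  case False
  then have "T x \<in> {1..N}"
    using filling_entry[OF T assms] by (auto split: if_splits)
  then have "a (T x) \<in> set vs"
    using set_vs by blast
  then obtain s where "s < length mu" "a (T x) = vs ! s"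
    unfolding in_set_conv_nth length_vs by metis
  then show ?thesis
    using False by (auto simp: label_def line_def)
qed (simp add: label_def line_def)

lemma labels_in_diagram: "y \<in> labels c \<Longrightarrow> \<exists>x\<in>young_diagram lam. label x = y \<and> snd x = c"
  unfolding labels_def by (force simp: in_young_diagram less_height_iff[OF lam])

lemma length_lam_le: "length lam \<le> Suc (length mu)"
proof (cases "lam = []")
  case False
  then have pos: "0 < row lam 0"
    using row_pos_iff[OF lam, of 0] by simp
  have "height lam 0 = length lam"
    by (rule nat_eqI_less) (simp add: less_height_iff[OF lam] row_pos_iff[OF lam])
  then have "length lam = card (labels 0)"
    using card_labels[OF pos] by simp
  also have "\<dots> \<le> card (insert var (val ` {..<length mu}))"
    using labels_in_diagram[of _ 0] label_cases by (intro card_mono) blast+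
  also have "\<dots> \<le> Suc (card (val ` {..<length mu}))"
    by (simp add: card_insert_if)
  also have "card (val ` {..<length mu}) \<le> length mu"
    using card_image_le[of "{..<length mu}" val] by simp
  finally show ?thesis
    by simp
qed simp

lemma card_overlap_le:
  assumes "i < length mu"
  shows "card (overlap i) \<le> l" "card (overlap i) \<le> row mu i"
proof -
  have bound: "card (overlap i) \<le> card {x \<in> young_diagram lam. label x = y}"
    if y: "\<And>c. c \<in> overlap i \<Longrightarrow> y \<in> labels c" for y
  proof -
    have "overlap i \<subseteq> snd ` {x \<in> young_diagram lam. label x = y}"
    proof
      fix c assume "c \<in> overlap i"
      then obtain x where "x \<in> young_diagram lam" "label x = y" "snd x = c"
        using labels_in_diagram[OF y] by blast
      then show "c \<in> snd ` {x \<in> young_diagram lam. label x = y}"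
        by blast
    qed
    then have "card (overlap i) \<le> card (snd ` {x \<in> young_diagram lam. label x = y})"
      by (rule card_mono[rotated]) simp
    also have "\<dots> \<le> card {x \<in> young_diagram lam. label x = y}"
      by (rule card_image_le) simp
    finally show ?thesis .
  qed
  show "card (overlap i) \<le> l"
    using bound[of var] by (simp add: overlap_def card_var_cells)
  show "card (overlap i) \<le> row mu i"
    using bound[of "val i"] by (simp add: overlap_def card_val_cells[OF assms])
qed

text \<open>Count the squares labelled by a value from \<open>S\<close> or by the variable. The labels within a column are
  distinct, so a column of height \<open>h\<close> has at most \<open>min h (card S)\<close> of them, and one more only if all of
  these \<open>card S + 1\<close> labels occur in it, in which case it lies in the overlap for \<open>i\<close>.\<close>

lemma card_overlap_ge:
  assumes S: "S \<subseteq> {..<length mu}" "i \<in> S"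
  shows "(\<Sum>s\<in>S. row mu s) + l \<le> (\<Sum>k<card S. row lam k) + card (overlap i)"
proof -
  let ?k = "card S" and ?Y = "young_diagram lam"
  define L where "L = insert var (val ` S)"
  have finS: "finite S"
    using S(1) finite_subset by blast
  have inj_val: "inj_on val {..<length mu}"
    using distinct_vs length_vs by (auto simp: inj_on_def nth_eq_iff_index_eq)
  then have inj_S: "inj_on val S"
    using S(1) inj_on_subset by blast
  have card_L: "card L = Suc ?k"
    unfolding L_def using finS card_image[OF inj_S] by (subst card_insert_disjoint) auto
  have "card {x \<in> ?Y. label x \<in> L} = card (\<Union>y\<in>L. {x \<in> ?Y. label x = y})"
    by (rule arg_cong[of _ _ card]) blast
  also have "\<dots> = (\<Sum>y\<in>L. card {x \<in> ?Y. label x = y})"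
    by (rule card_UN_disjoint) (use finS in \<open>auto simp: L_def\<close>)
  also have "\<dots> = l + (\<Sum>y\<in>val ` S. card {x \<in> ?Y. label x = y})"
    unfolding L_def using finS card_var_cells by (subst sum.insert) auto
  also have "(\<Sum>y\<in>val ` S. card {x \<in> ?Y. label x = y}) = (\<Sum>s\<in>S. card {x \<in> ?Y. label x = val s})"
    using sum.reindex[OF inj_S] by simp
  also have "\<dots> = (\<Sum>s\<in>S. row mu s)"
    by (rule sum.cong) (use S card_val_cells in auto)
  finally have total: "card {x \<in> ?Y. label x \<in> L} = l + (\<Sum>s\<in>S. row mu s)" .
  have per_column: "card {r \<in> {..<height lam c}. label (r, c) \<in> L}
      \<le> card {r \<in> {..<height lam c}. r < ?k} + (if c \<in> overlap i then 1 else 0)" if c: "c < row lam 0" for c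
  proof -
    let ?W = "{r \<in> {..<height lam c}. label (r, c) \<in> L}"
    have inj: "inj_on (\<lambda>r. label (r, c)) ?W"
      using inj_label[OF c] by (rule inj_on_subset) auto
    have sub: "(\<lambda>r. label (r, c)) ` ?W \<subseteq> L"
      by auto
    have finL: "finite L"
      using finS by (simp add: L_def)
    have W: "card ?W \<le> Suc ?k" "card ?W \<le> height lam c"
      using card_mono[OF finL sub] card_image[OF inj] card_L card_mono[of "{..<height lam c}" ?W] by auto
    have "{r \<in> {..<height lam c}. r < ?k} = {..<min (height lam c) ?k}"
      by auto
    then have min: "card {r \<in> {..<height lam c}. r < ?k} = min (height lam c) ?k"
      by simp
    show ?thesis
    proof (cases "card ?W = Suc ?k")
      case True
      then have "(\<lambda>r. label (r, c)) ` ?W = L"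
        using card_subset_eq[OF finL sub] card_image[OF inj] card_L by simp
      moreover have "(\<lambda>r. label (r, c)) ` ?W \<subseteq> labels c"
        by (auto simp: labels_def)
      ultimately have "L \<subseteq> labels c"
        by simp
      then have "c \<in> overlap i"
        using S(2) c by (auto simp: overlap_def L_def)
      then show ?thesis
        using True W min by simp
    qed (use W min in auto)
  qed
  have count_columns: "card {x \<in> ?Y. P x} = (\<Sum>c<row lam 0. card {r \<in> {..<height lam c}. P (r, c)})" for P
  proof -
    have "card {x \<in> ?Y. P x} = (\<Sum>x\<in>?Y. if P x then 1 else 0)"
      by (simp add: sum.If_cases Int_def)
    also have "\<dots> = (\<Sum>c<row lam 0. \<Sum>r<height lam c. if P (r, c) then 1 else 0)"
      by (rule sum_young_diagram_columns[OF lam order_refl])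
    also have "\<dots> = (\<Sum>c<row lam 0. card {r \<in> {..<height lam c}. P (r, c)})"
      by (simp add: sum.If_cases Int_def)
    finally show ?thesis .
  qed
  have "card {x \<in> ?Y. label x \<in> L} \<le>
      (\<Sum>c<row lam 0. card {r \<in> {..<height lam c}. r < ?k} + (if c \<in> overlap i then 1 else 0))"
    unfolding count_columns by (rule sum_mono) (use per_column in auto)
  also have "\<dots> = card {x \<in> ?Y. fst x < ?k} + card (overlap i)"
  proof -
    have "overlap i \<subseteq> {..<row lam 0}"
      by (auto simp: overlap_def)
    then have "(\<Sum>c<row lam 0. if c \<in> overlap i then 1 else 0) = card (overlap i)"
      by (simp add: sum.If_cases Int_absorb1)
    then show ?thesis
      unfolding count_columns sum.distrib by simp
  qed
  also have "card {x \<in> ?Y. fst x < ?k} = (\<Sum>k<?k. row lam k)"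
  proof -
    have "{x \<in> ?Y. fst x < ?k} = (SIGMA k:{..<?k}. {..<row lam k})"
      by (auto simp: in_young_diagram)
    then show ?thesis
      by (simp add: card_SigmaI)
  qed
  finally show ?thesis
    using total by simp
qed

text \<open>Each column in the overlap contributes a factor \<open>\<plusminus>(x - v)\<close> with \<open>v\<close> the value number \<open>i\<close>.\<close>

lemma power_dvd_fibre_poly: "[:- (vs ! i), 1:] ^ card (overlap i) dvd fibre_poly a (Suc N) (specht_poly lam T)"
proof -
  define D where "D c = (\<Prod>(r, r')\<in>{(r, r'). r < r' \<and> r' < height lam c}. label (r, c) - label (r', c))" for c
  have "[:- (vs ! i), 1:] dvd D c" if c: "c \<in> overlap i" for c
  proof -
    obtain r r' where r: "r < height lam c" "label (r, c) = val i" "r' < height lam c" "label (r', c) = var"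
      using c unfolding overlap_def labels_def by auto
    have "r \<noteq> r'"
      using r val_neq_var by metis
    show ?thesis
    proof (cases "r < r'")
      case True
      have "(case (r, r') of (r, r') \<Rightarrow> label (r, c) - label (r', c)) dvd D c"
        unfolding D_def using True r finite_pairs by (intro dvd_prodI) auto
      then have "- (var - val i) dvd D c"
        unfolding prod.case r(2,4) minus_diff_eq .
      moreover have "[:- (vs ! i), 1:] = var - val i"
        by simp
      ultimately show ?thesis
        by (simp only: minus_dvd_iff)
    next
      case False
      have "(case (r', r) of (r, r') \<Rightarrow> label (r, c) - label (r', c)) dvd D c"
        unfolding D_def using False \<open>r \<noteq> r'\<close> r finite_pairs by (intro dvd_prodI) auto
      then have "var - val i dvd D c"
        unfolding prod.case r(2,4) .
      moreover have "[:- (vs ! i), 1:] = var - val i"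
        by simp
      ultimately show ?thesis
        by (simp only:)
    qed
  qed
  then have "(\<Prod>c\<in>overlap i. [:- (vs ! i), 1:]) dvd (\<Prod>c\<in>overlap i. D c)"
    by (rule prod_dvd_prod)
  also have "\<dots> dvd (\<Prod>c<row lam 0. D c)"
    by (rule prod_dvd_prod_subset) (auto simp: overlap_def)
  finally show ?thesis
    by (simp add: fibre_poly_eq D_def)
qed

lemma required_overlap_le_overlap: "i < length mu \<Longrightarrow> required_overlap lam mu l i \<le> card (overlap i)"
  using required_overlap_le[of i mu l lam "card (overlap i)"] card_overlap_ge by blast

end

section \<open>The Groebner basis\<close>

lemma sum_order_le_degree:
  fixes Q :: "'a::idom poly"
  assumes "Q \<noteq> 0" "finite V"
  shows "(\<Sum>v\<in>V. order v Q) \<le> degree Q"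
proof -
  have "(\<Sum>v\<in>V. order v Q) = (\<Sum>v\<in>V. count (proots Q) v)"
    using assms(1) by simp
  also have "\<dots> \<le> (\<Sum>v\<in>V \<union> set_mset (proots Q). count (proots Q) v)"
    using assms(2) by (intro sum_mono2) auto
  also have "\<dots> = (\<Sum>v\<in>set_mset (proots Q). count (proots Q) v)"
    using assms(2) by (intro sum.mono_neutral_right) (auto simp: not_in_iff)
  also have "\<dots> = size (proots Q)"
    by (simp add: size_multiset_overloaded_eq)
  also have "\<dots> \<le> degree Q"
    by (rule size_proots_le)
  finally show ?thesis .
qed

text \<open>On the line over a point of type \<open>mu\<close>, all generators of the ideal, hence also \<open>f\<close>, have at each
  value of the point a zero of at least the required order. If \<open>f\<close> does not vanish on the line, its
  degree there bounds the sum of these orders, which is the weight of a suitable strip. Membership in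
  the ideal enters through the multiplicities of the zeros: vanishing of \<open>f\<close> on the zero set of the
  ideal would give simple zeros only.\<close>

lemma ex_strip_of_specht_ideal:
  fixes f :: "'k::field mpoly"
  assumes lam: "is_partition lam" "sum_list lam = N + l"
    and f: "f \<in> specht_ideal (Suc N) lam l" and Q: "fibre_poly a (Suc N) f \<noteq> 0"
    and type: "point_type N a vs mu"
  shows "\<exists>rho. is_partition rho \<and> horizontal_strip mu rho \<and> sum_list rho = N + l \<and> l \<le> row rho 0 \<and>
    (\<forall>k. (\<Sum>i<k. row rho i) \<le> (\<Sum>i<k. row lam i)) \<and>
    (\<Sum>i<length rho. i * (row rho i - row mu i)) \<le> degree (fibre_poly a (Suc N) f)"
proof -
  let ?Q = "fibre_poly a (Suc N) f"
  obtain H c where H: "f = (\<Sum>h\<in>H. c h * h)" "H \<subseteq> specht_poly lam ` Tab (Suc N) lam l"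
    using f unfolding specht_ideal_def ideal_gen_def by blast
  have Q_eq: "?Q = (\<Sum>h\<in>H. fibre_poly a (Suc N) (c h) * fibre_poly a (Suc N) h)"
    unfolding H(1) const_hom.insertion_sum const_hom.insertion_mult ..
  have on_line: "filling_on_line a N l vs mu lam T"
    if "T \<in> Tab (Suc N) lam l" "fibre_poly a (Suc N) (specht_poly lam T) \<noteq> 0" for T
    using that type lam(1) Tab_filling by unfold_locales
  have "\<exists>h\<in>H. fibre_poly a (Suc N) h \<noteq> 0"
  proof (rule ccontr)
    assume "\<not> ?thesis"
    then have "?Q = 0"
      unfolding Q_eq by (intro sum.neutral) simp
    then show False
      using Q by blast
  qed
  then obtain h where "h \<in> H" "fibre_poly a (Suc N) h \<noteq> 0"
    by blast
  then obtain T0 where T0: "T0 \<in> Tab (Suc N) lam l" "fibre_poly a (Suc N) (specht_poly lam T0) \<noteq> 0"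
    using H(2) by blast
  interpret T0: filling_on_line a N l vs mu lam T0
    using on_line[OF T0] .
  have sum_mu: "sum_list mu = N"
  proof -
    have "N = card (\<Union>v\<in>set vs. {j \<in> {1..N}. a j = v})"
    proof -
      have "(\<Union>v\<in>set vs. {j \<in> {1..N}. a j = v}) = {1..N}"
        using T0.set_vs by auto
      then show ?thesis
        by simp
    qed
    also have "\<dots> = (\<Sum>v\<in>set vs. card {j \<in> {1..N}. a j = v})"
      by (rule card_UN_disjoint) auto
    also have "\<dots> = sum_list (map (\<lambda>v. card {j \<in> {1..N}. a j = v}) vs)"
      by (rule sum_list_distinct_conv_sum_set[OF T0.distinct_vs, symmetric])
    also have "map (\<lambda>v. card {j \<in> {1..N}. a j = v}) vs = mu"
      using type unfolding point_type_def by blast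
    finally show ?thesis
      by simp
  qed
  let ?m = "required_overlap lam mu l"
  have m_le: "?m i \<le> l" "?m i \<le> row mu i" if "i < length mu" for i
    using T0.required_overlap_le_overlap[OF that] T0.card_overlap_le[OF that] by linarith+
  obtain rho where rho: "is_partition rho" "horizontal_strip mu rho" "sum_list rho = sum_list mu + l" "l \<le> row rho 0"
    "\<And>k. (\<Sum>i<k. row rho i) \<le> (\<Sum>i<k. row lam i)"
    "(\<Sum>i<length rho. i * (row rho i - row mu i)) = (\<Sum>i<length mu. ?m i)"
    using ex_horizontal_strip[OF T0.mu lam(1) _ T0.length_lam_le m_le] lam(2) sum_mu by auto
  have "?m i \<le> order (vs ! i) ?Q" if i: "i < length mu" for i
  proof -
    have "[:- (vs ! i), 1:] ^ ?m i dvd fibre_poly a (Suc N) h" if h: "h \<in> H" for h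
    proof (cases "fibre_poly a (Suc N) h = 0")
      case False
      obtain T where T: "T \<in> Tab (Suc N) lam l" "h = specht_poly lam T"
        using H(2) h by blast
      interpret T: filling_on_line a N l vs mu lam T
        using on_line[OF T(1)] False T(2) by simp
      show ?thesis
        unfolding T(2) using le_imp_power_dvd[OF T.required_overlap_le_overlap[OF i]] T.power_dvd_fibre_poly[of i]
        by (rule dvd_trans)
    qed simp
    then have "[:- (vs ! i), 1:] ^ ?m i dvd ?Q"
      unfolding Q_eq by (intro dvd_sum dvd_mult)
    then show ?thesis
      using Q by (simp add: order_divides)
  qed
  then have "(\<Sum>i<length mu. ?m i) \<le> (\<Sum>i<length mu. order (vs ! i) ?Q)"
    by (intro sum_mono) simp
  also have "\<dots> = (\<Sum>v\<in>set vs. order v ?Q)"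
    using T0.distinct_vs T0.length_vs
    by (intro sum.reindex_bij_betw bij_betw_nth) simp_all
  also have "\<dots> \<le> degree ?Q"
    using sum_order_le_degree[OF Q] by simp
  finally have "(\<Sum>i<length rho. i * (row rho i - row mu i)) \<le> degree ?Q"
    by (simp add: rho(6))
  then show ?thesis
    using rho(1-5) sum_mu by auto
qed

lemma finite_STab: "finite (STab n rho l)"
proof (rule finite_subset)
  show "STab n rho l \<subseteq> PiE (young_diagram rho) (\<lambda>_. set_mset (mset [1..<n] + replicate_mset l n))"
  proof
    fix T assume "T \<in> STab n rho l"
    then have "T \<in> extensional (young_diagram rho)" "filling (mset [1..<n] + replicate_mset l n) rho T"
      by (auto simp: STab_def Tab_def filling_def)
    then show "T \<in> PiE (young_diagram rho) (\<lambda>_. set_mset (mset [1..<n] + replicate_mset l n))"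
      by (simp only: PiE_iff) (blast intro: filling_entry)
  qed
  show "finite (PiE (young_diagram rho) (\<lambda>_. set_mset (mset [1..<n] + replicate_mset l n)))"
    by (rule finite_PiE) auto
qed

lemma finite_partitions: "finite (partitions m)"
proof (rule finite_subset)
  show "partitions m \<subseteq> {xs. set xs \<subseteq> {..m} \<and> length xs \<le> m}"
  proof
    fix mu assume mu: "mu \<in> partitions m"
    then have "is_partition mu" "sum_list mu = m"
      by (auto simp: partitions_iff)
    moreover have "length mu \<le> sum_list mu" if "\<forall>x\<in>set mu. 0 < x" for mu :: "nat list"
      using that by (induction mu) auto
    ultimately show "mu \<in> {xs. set xs \<subseteq> {..m} \<and> length xs \<le> m}"
      using member_le_sum_list[of _ mu] by (auto simp: is_partition_def)
  qed
  show "finite {xs. set xs \<subseteq> {..m} \<and> length xs \<le> m}"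
    by (rule finite_lists_length_le) simp
qed

lemma hd_eq_row: "lam \<noteq> [] \<Longrightarrow> hd lam = row lam 0"
  by (simp add: row_def hd_conv_nth)

lemma specht_ideal_subset_poly_ring: "1 \<le> n \<Longrightarrow> is_partition lam \<Longrightarrow> specht_ideal n lam l \<subseteq> poly_ring n"
  unfolding specht_ideal_def
proof (intro ideal_gen_subset_poly_ring image_subsetI)
  fix T assume n: "1 \<le> n" and lam: "is_partition lam" and T: "T \<in> Tab n lam l"
  have "set (column lam T c) \<subseteq> {1..n}" for c
  proof
    fix x assume "x \<in> set (column lam T c)"
    then obtain i where "(i, c) \<in> young_diagram lam" "x = T (i, c)"
      by (auto simp: column_def)
    then show "x \<in> {1..n}"
      using filling_entry[OF Tab_filling[OF T], of "(i, c)"] n by (auto split: if_splits)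
  qed
  then show "specht_poly lam T \<in> poly_ring n"
    unfolding specht_poly_def by (intro prod_in_poly_ring difference_product_in_poly_ring)
qed

theorem theorem3p8:
  fixes n l :: nat and lam :: "nat list" and F :: "nat list set"
  assumes "infinite (UNIV :: 'k::field set)"
    and "n \<ge> 1" and "l \<ge> 1"
    and "lam \<in> partitions_ge (n + l - 1) l"
    and "F = {rho \<in> partitions_ge (n + l - 1) l. rho \<unlhd> lam}"
  shows "is_groebner_basis n lex_less
           {specht_poly rho T | rho T. rho \<in> F \<and> T \<in> STab n rho l}
           (specht_ideal n lam l :: 'k mpoly set)"
proof -
  obtain N where n: "n = Suc N"
    using assms(2) by (cases n) auto
  let ?C = "mset [1..<n] + replicate_mset l n"
  have lam: "is_partition lam" "sum_list lam = N + l"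
    using assms(4) by (auto simp: partitions_ge_def partitions_iff n)
  have F_iff: "rho \<in> F \<longleftrightarrow> is_partition rho \<and> sum_list rho = N + l \<and> l \<le> row rho 0 \<and>
      (\<forall>k. (\<Sum>i<k. row rho i) \<le> (\<Sum>i<k. row lam i))" for rho
  proof -
    have "rho \<noteq> []" if "l \<le> row rho 0"
      using that assms(3) by (auto simp: row_def)
    then show ?thesis
      using dominated_iff[of rho lam] lam hd_eq_row[of rho]
      by (auto simp: assms(5) partitions_ge_def partitions_iff n)
  qed
  have STab: "STab n rho l = {T. standard_filling ?C rho T}" for rho
    by (rule STab_eq)
  let ?G = "{specht_poly rho T | rho T. rho \<in> F \<and> T \<in> STab n rho l} :: 'k mpoly set"
  have leading: "leading (specht_poly rho T :: 'k mpoly) (specht_monomial rho T)" if "rho \<in> F" "T \<in> STab n rho l" for rho T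
    using that leading_specht_poly[of rho ?C T] by (simp add: F_iff STab)
  show ?thesis
  proof (rule groebner_basisI)
    have "?G = (\<lambda>(rho, T). specht_poly rho T) ` (SIGMA rho:F. STab n rho l)"
      by auto
    moreover have "finite F"
      unfolding assms(5) partitions_ge_def by (rule finite_subset[OF _ finite_partitions[of "n + l - 1"]]) auto
    ultimately show "finite ?G"
      using finite_STab by (simp add: finite_SigmaI)
    show "?G \<subseteq> specht_ideal n lam l"
    proof safe
      fix rho T assume "rho \<in> F" "T \<in> STab n rho l"
      then show "specht_poly rho T \<in> specht_ideal n lam l"
        using specht_ideal_dominated[OF lam(1), of rho n l T] assms(2) lam(2)
        by (auto simp: F_iff STab standard_filling_def filling_def)
    qed
    show "0 \<notin> ?G"
      using leading leading_nonzero by fastforce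
    show "specht_ideal n lam l \<subseteq> poly_ring n"
      using assms(2) lam(1) by (rule specht_ideal_subset_poly_ring)
    fix f :: "'k mpoly"
    assume f: "f \<in> specht_ideal n lam l" "f \<noteq> 0"
    let ?m = "initial_monomial lex_less f"
    define d where "d = Poly_Mapping.lookup ?m (Suc N)"
    define g where "g = degree_part (Suc N) d f"
    have "f \<in> poly_ring n"
      using f(1) specht_ideal_subset_poly_ring[OF assms(2) lam(1)] by blast
    have zero: "Poly_Mapping.lookup m j = 0" if "m \<in> Poly_Mapping.keys f" "j \<notin> {1..Suc N}" for m j
    proof -
      have "Poly_Mapping.keys m \<subseteq> {1..Suc N}"
        using \<open>f \<in> poly_ring n\<close> that(1) unfolding poly_ring_def n by blast
      then have "j \<notin> Poly_Mapping.keys m"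
        using that(2) by blast
      then show ?thesis
        by (simp add: in_keys_iff)
    qed
    then have "constant_outside (Suc N) f"
      unfolding constant_outside_def by metis
    note top = top_degree_part[OF f(2) this, folded d_def, folded g_def]
    define F' where "F' = {mu. \<exists>rho\<in>F. horizontal_strip mu rho \<and>
       (\<Sum>i<length rho. i * (row rho i - row mu i)) \<le> d}"
    have "mu \<in> F'" if a: "\<And>j. j \<notin> {1..N} \<Longrightarrow> a j = 1" and type: "point_type N a vs mu" and nz: "mpeval a g \<noteq> 0" for a vs mu
    proof -
      have "a (Suc N) = 1"
        using a by simp
      then have Q: "degree (fibre_poly a (Suc N) f) \<le> d" "coeff (fibre_poly a (Suc N) f) d \<noteq> 0"
        using degree_fibre_poly_le[of a "Suc N" f d] top(1) coeff_fibre_poly[of a "Suc N" f d] nz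
        by (auto simp: g_def)
      then have "fibre_poly a (Suc N) f \<noteq> 0"
        by auto
      from ex_strip_of_specht_ideal[OF lam f(1)[unfolded n] this type]
      obtain rho where "rho \<in> F" "horizontal_strip mu rho"
          "(\<Sum>i<length rho. i * (row rho i - row mu i)) \<le> degree (fibre_poly a (Suc N) f)"
        unfolding F_iff by blast
      then show ?thesis
        using Q(1) le_trans unfolding F'_def by blast
    qed
    then obtain mu T where mu: "mu \<in> F'" "is_partition mu" "sum_list mu = N" "standard_filling (mset [1..<Suc N]) mu T"
      "\<And>i. Poly_Mapping.lookup (specht_monomial mu T) i \<le> Poly_Mapping.lookup (initial_monomial lex_less g) i"
      using initial_monomial_of_vanishing_poly[OF assms(1) leading_nonzero[OF top(2)] top(3), of F'] by blast
    then obtain rho where rho: "rho \<in> F" "horizontal_strip mu rho"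
        "(\<Sum>i<length rho. i * (row rho i - row mu i)) \<le> d"
      unfolding F'_def by blast
    have init: "initial_monomial lex_less g = ?m"
      using top(2) by (rule initial_monomial_eq)
    have rho': "is_partition rho" "sum_list rho = sum_list mu + l"
      using rho(1) mu(3) by (auto simp: F_iff)
    obtain T' where T': "standard_filling (mset [1..<Suc N] + replicate_mset l (Suc N)) rho T'"
        "\<And>i. Poly_Mapping.lookup (specht_monomial rho T') i \<le> Poly_Mapping.lookup ?m i"
      using standard_filling_extend_divides[OF mu(2) rho'(1) rho(2) mu(4) rho'(2) mu(5)[unfolded init]]
        rho(3) unfolding d_def by blast
    have "T' \<in> STab n rho l"
      using T'(1) unfolding STab by (simp only: n mem_Collect_eq)
    moreover from this have "initial_monomial lex_less (specht_poly rho T' :: 'k mpoly) = specht_monomial rho T'"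
      using leading[OF rho(1)] by (intro initial_monomial_eq)
    ultimately show "\<exists>g\<in>?G. \<forall>i. Poly_Mapping.lookup (initial_monomial lex_less g) i \<le> Poly_Mapping.lookup ?m i"
      using rho(1) T'(2) by (intro bexI[of _ "specht_poly rho T'"]) auto
  qed
qed

end
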